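(* Let $P,Q$ be non-zero integers with $\gcd(P,Q)=1$ and $(P,Q)\notin\{(\pm 1,1),(\pm 2,1)\}$. Then: (i) $U_2(P,Q)$ is a perfect square if and only if $P=a^2$ for some integer $a$. (ii) $U_3(P,Q)$ is a perfect square if and only if $P^2-Q=a^2$ for some integer $a$. (iii) $U_4(P,Q)$ is a perfect square if and only if there are $\delta\in\{1,-1\}$ and integers $a,b$ such that either $P=\delta a^2$, $Q=\frac12(a^4-\delta b^2)$ with $ab$ odd, or $P=2\delta a^2$, $Q=2a^4-\delta b^2$ with $b$ odd. (iv) $U_5(P,Q)$ is a perfect square if and only if there are coprime non-zero integers $a,b$ with $5\nmid b$ such that either $a,b$ are of opposite parity and $(P,Q)=(2ab,\;5a^4+6a^2b^2+b^4)$ or $(P,Q)=(2ab,\;-5a^4+6a^2b^2-b^4)$; or $a,b$ are both odd and $(P,Q)=(ab,\;\frac14(5a^4+6a^2b^2+b^4))$ or $(P,Q)=(ab,\;\frac14(-5a^4+6a^2b^2-b^4))$. (v) $U_6(P,Q)$ is a perfect square if and only if there are integers $a,b$ such that one of the following seven cases holds: $P=a^2$, $P^2-Q=b^2$, and $-2a^4+3b^2$ is a perfect square; $P=a^2$, $P^2-Q=-2b^2$, and $a^4+3b^2$ is a perfect square; $P=-a^2$, $P^2-Q=2b^2$, and $a^4-3b^2$ is a perfect square; or, for some $\delta\in\{1,-1,2,-2\}$ (four cases), $P=3a^2$, $P^2-Q=\delta b^2$, and $-\frac{6}{\delta}a^4+b^2$ is a perfect square. (vi) The elliptic curve $E: y^2=x^3+6x^2+5x+1$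 over $\mathbb{Q}$ has trivial torsion and rank $1$, with $E(\mathbb{Q})$ generated by $P_0=(-1,1)$; and $U_7(P,Q)$ is a perfect square if and only if $-Q/P^2$ is the $x$-coordinate of a multiple $mP_0$ for some non-zero integer $m$.
   Context: For non-zero integers $P,Q$ the Lucas sequence $\{U_n(P,Q)\}_{n\ge 0}$ is defined by $U_0=0$, $U_1=1$, $U_n=P\,U_{n-1}-Q\,U_{n-2}$ for $n\geq 2$. A perfect square is the square of an integer. *)

theory Defs
  imports
    "HOL-Algebra.Free_Abelian_Groups"
    "HOL-Algebra.Generated_Groups"
    "HOL-Computational_Algebra.Nth_Powers"
begin

fun lucas_U :: "int \<Rightarrow> int \<Rightarrow> nat \<Rightarrow> int" where
  "lucas_U P Q 0 = 0"
| "lucas_U P Q (Suc 0) = 1"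
| "lucas_U P Q (Suc (Suc n)) = P * lucas_U P Q (Suc n) - Q * lucas_U P Q n"

datatype 'a ell_point = Infinity | Affine 'a 'a

fun on_curve :: "'a::field_char_0 \<Rightarrow> 'a \<Rightarrow> 'a \<Rightarrow> 'a ell_point \<Rightarrow> bool" where
  "on_curve a b c Infinity \<longleftrightarrow> True"
| "on_curve a b c (Affine x y) \<longleftrightarrow> y^2 = x^3 + a * x^2 + b * x + c"

text \<open>The curve \<open>y\<^sup>2 = x\<^sup>3 + a x\<^sup>2 + b x + c\<close> is an elliptic curve iff its discriminant, 16 times
  the discriminant of the cubic, does not vanish.\<close>

definition ell_discriminant :: "'a::field_char_0 \<Rightarrow> 'a \<Rightarrow> 'a \<Rightarrow> 'a" where
  "ell_discriminant a b c = 16 * (a^2 * b^2 - 4 * b^3 - 4 * a^3 * c + 18 * a * b * c - 27 * c^2)"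

definition is_elliptic_curve :: "'a::field_char_0 \<Rightarrow> 'a \<Rightarrow> 'a \<Rightarrow> bool" where
  "is_elliptic_curve a b c \<longleftrightarrow> ell_discriminant a b c \<noteq> 0"

text \<open>Chord and tangent addition. A line of slope \<open>l\<close> meets the curve in three points whose
  \<open>x\<close>-coordinates sum to \<open>l\<^sup>2 - a\<close>. The coefficient \<open>c\<close> does not enter the formulas.\<close>

definition third_point :: "'a::field_char_0 \<Rightarrow> 'a \<Rightarrow> 'a \<Rightarrow> 'a \<Rightarrow> 'a \<Rightarrow> 'a ell_point" where
  "third_point a l x1 y1 x2 =
     (let x3 = l^2 - a - x1 - x2 in Affine x3 (l * (x1 - x3) - y1))"

fun ell_add :: "'a::field_char_0 \<Rightarrow> 'a \<Rightarrow> 'a ell_point \<Rightarrow> 'a ell_point \<Rightarrow> 'a ell_point" where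
  "ell_add a b Infinity p = p"
| "ell_add a b (Affine x1 y1) Infinity = Affine x1 y1"
| "ell_add a b (Affine x1 y1) (Affine x2 y2) =
     (if x1 \<noteq> x2 then third_point a ((y2 - y1) / (x2 - x1)) x1 y1 x2
      else if y1 = - y2 then Infinity
      else third_point a ((3 * x1^2 + 2 * a * x1 + b) / (2 * y1)) x1 y1 x2)"

text \<open>The group of points with coordinates in the field \<open>'a\<close>.\<close>

definition ell_group :: "'a::field_char_0 \<Rightarrow> 'a \<Rightarrow> 'a \<Rightarrow> 'a ell_point monoid" where
  "ell_group a b c =
     \<lparr>carrier = {p. on_curve a b c p}, monoid.mult = ell_add a b, one = Infinity\<rparr>"

definition torsion :: "('a, 'm) monoid_scheme \<Rightarrow> 'a set" where
  "torsion G = {x \<in> carrier G. \<exists>n::nat. n > 0 \<and> x [^]\<^bsub>G\<^esub> n = \<one>\<^bsub>G\<^esub>}"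

text \<open>Rank as in the Mordell--Weil theorem: \<open>G\<close> is isomorphic to the product of its torsion
  subgroup with a free abelian group on \<open>r\<close> generators.\<close>

definition has_rank :: "('a, 'm) monoid_scheme \<Rightarrow> nat \<Rightarrow> bool" where
  "has_rank G r \<longleftrightarrow> G \<cong> (G\<lparr>carrier := torsion G\<rparr> \<times>\<times> free_Abelian_group {..<r})"

definition E7 :: "rat ell_point monoid" where
  "E7 = ell_group 6 5 1"

end

(*
A square Lucas number factors into nearly coprime parts, each of which is then a square up to a small factor.

Put z = x + 1, so that E7 is y^2 = f(z) with f(z) = z^3 + 3 z^2 - 4 z + 1 and P0 = (0, 1). A point is described by z and
the slope u of the line through P0; then adding P0 is z -> u^2 - 3 - z, and the identity (P + P0) + Q = P + (Q + P0), which
is all the associativity that is needed, can be checked by hand. Hence n -> n P0 is additive, and it is injective since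
E7 has no rational 2-torsion and P0 is not the double of a rational point. For surjectivity let z = m / s^2. If z > 1/2
then m - s^2 theta, where theta is a root of f, is totally positive with square norm. The ring Z[theta] has
discriminant 49, and Hermite's bound for ternary forms shows that m - s^2 theta is a square in it. This gives R with
2 R = P or 2 R = -P, of smaller height. Points with z < 1/2 are moved to z > 1/2 by adding P0 or -P0.
*)

theory Submission
  imports Defs Complex_Main
begin

subsection \<open>Lucas numbers of small index\<close>

text \<open>A classical 2-descent would need the class group and the units of the cubic ring. Both
  are avoided: the squares of the elements of a suitable ideal, divided by m - s^2 theta, have
  integral traces, and the discriminant 49 is so small that Hermite's bound produces a nonzero
  quotient of trace at most 4. The only totally positive element with such a trace is 1. Total
  positivity thus takes the place of a discussion of units, and it is the reason for working on the
  unbounded real component; 1/2 is a convenient rational number between the two larger roots. The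
  height estimates dictate the finite check. Halving a point of height H gives fourth power of the
  height at most 4 H, and a preceding shift turns height h into at most 6 h^2. Since 24 h^2 < h^4
  for h >= 5, only heights up to 4 have to be inspected by hand.\<close>

lemma coprime_mult_eq_even_power:
  fixes a b c :: int
  assumes "coprime a b" "a * b = c ^ n" "even n" "n > 0"
  shows "\<exists>e\<in>{1,-1}. \<exists>u v. a = e * u ^ n \<and> b = e * v ^ n"
proof -
  have "nat \<bar>a\<bar> * nat \<bar>b\<bar> = nat \<bar>c\<bar> ^ n"
    using assms(2) by (metis abs_mult nat_mult_distrib abs_ge_zero power_abs nat_power_eq)
  moreover have "coprime (nat \<bar>a\<bar>) (nat \<bar>b\<bar>)"
    using assms(1) by (simp add: coprime_nat_abs_left_iff coprime_nat_abs_right_iff)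
  ultimately have "is_nth_power n (nat \<bar>a\<bar>)" "is_nth_power n (nat \<bar>b\<bar>)"
    using is_nth_power_mult_coprime_nat_iff[of "nat \<bar>a\<bar>" "nat \<bar>b\<bar>" n]
      by (auto simp: is_nth_power_def)
  then obtain u v where "nat \<bar>a\<bar> = u ^ n" "nat \<bar>b\<bar> = v ^ n" by (auto simp: is_nth_power_def)
  then have u: "\<bar>a\<bar> = int u ^ n" and v: "\<bar>b\<bar> = int v ^ n"
    by (metis abs_ge_zero nat_0_le of_nat_power)+
  have ab: "a * b \<ge> 0" using assms by (simp add: zero_le_even_power)
  show ?thesis
  proof (cases "a = 0 \<or> b = 0")
    case False
    then have "a > 0 \<and> b > 0 \<or> a < 0 \<and> b < 0" using ab by (auto simp: zero_le_mult_iff)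
    then show ?thesis
    proof
      assume "a > 0 \<and> b > 0"
      then show ?thesis using u v by (intro bexI[of _ 1] exI[of _ "int u"] exI[of _ "int v"]) auto
    next
      assume "a < 0 \<and> b < 0"
      then show ?thesis using u v by (intro bexI[of _ "-1"] exI[of _ "int u"] exI[of _ "int v"]) auto
    qed
  next
    case True
    \<comment> \<open>Zero is compatible with either sign, so the other factor decides.\<close>
    define e :: int where "e = (if a < 0 \<or> b < 0 then -1 else 1)"
    have "a = e * int u ^ n" "b = e * int v ^ n" 
      using True u v by (auto simp: e_def abs_if split: if_splits)
    moreover have "e \<in> {1,-1}" by (simp add: e_def)
    ultimately show ?thesis by blast
  qed
qed

lemma coprime_add_multI:
  fixes a b c k :: int
  assumes "coprime a b" "c = k * a + b"
  shows "coprime a c"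
  using assms(1) unfolding assms(2) coprime_iff_gcd_eq_1 by (metis add.commute gcd_add_mult)

lemma coprime_mult_eq_even_powerE:
  fixes a b c :: int
  assumes "coprime a b" "a * b = c ^ n" "even n" "n > 0"
  obtains e u v where "e = 1 \<or> e = -1" "a = e * u ^ n" "b = e * v ^ n"
  using coprime_mult_eq_even_power[OF assms] by blast

lemmas coprime_mult_eq_squareE = coprime_mult_eq_even_powerE[where n = 2, simplified]
  and coprime_mult_eq_fourth_powerE = coprime_mult_eq_even_powerE[where n = 4, simplified]

lemma square_mod_3: "(x::int)^2 mod 3 = (if 3 dvd x then 0 else 1)"
proof -
  have "x^2 mod 3 = (x mod 3)^2 mod 3" by (rule power_mod[symmetric])
  moreover have "x mod 3 = 0 \<or> x mod 3 = 1 \<or> x mod 3 = 2" by presburger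
  ultimately show ?thesis unfolding dvd_eq_mod_eq_0 by (elim disjE) (simp_all only:, simp_all)
qed

lemma lucas_U_2: "lucas_U P Q 2 = P"
  and lucas_U_3: "lucas_U P Q 3 = P^2 - Q"
  and lucas_U_4: "lucas_U P Q 4 = P * (P^2 - 2*Q)"
  and lucas_U_5: "lucas_U P Q 5 = P^4 - 3*P^2*Q + Q^2"
  and lucas_U_6: "lucas_U P Q 6 = P * (P^2 - Q) * (P^2 - 3*Q)"
  and lucas_U_7: "lucas_U P Q 7 = P^6 - 5*P^4*Q + 6*P^2*Q^2 - Q^3"
  by (simp_all add: eval_nat_numeral algebra_simps)

lemma is_square_iff: "is_square (x::int) \<longleftrightarrow> (\<exists>y. x = y^2)"
  by (simp add: is_nth_power_def)

lemma half_rat_of_int: "2 * Q = k \<Longrightarrow> rat_of_int Q = 1/2 * rat_of_int k"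
  by auto

text \<open>The factors \<open>P\<close> and \<open>P^2 - 2*Q\<close> are coprime when
  \<open>P\<close> is odd. When \<open>P\<close> is even, a factor 2 comes out of each and the
  halves are coprime. So the parity of \<open>P\<close> selects the alternative, and \<delta> is the
  common sign of the two coprime factors.\<close>

theorem lucas_U_4_square_iff:
  fixes P Q :: int
  assumes P0: "P \<noteq> 0" and cop: "coprime P Q"
  shows "is_square (lucas_U P Q 4) \<longleftrightarrow>
        (\<exists>\<delta>\<in>{1, -1 :: int}. \<exists>a b :: int.
            (P = \<delta> * a^2 \<and> rat_of_int Q = 1/2 * rat_of_int (a^4 - \<delta> * b^2) \<and> odd (a * b))
          \<or> (P = 2 * \<delta> * a^2 \<and> Q = 2 * a^4 - \<delta> * b^2 \<and> odd b))"
    (is "_ \<longleftrightarrow> ?R")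
proof
  assume "is_square (lucas_U P Q 4)"
  then obtain c where c: "P * (P^2 - 2*Q) = c^2" by (auto simp: lucas_U_4 is_square_iff)
  show ?R
  proof (cases "even P")
    case False
    have "coprime P (-2 * Q)" using cop False by (simp add: coprime_mult_right_iff)
    then have "coprime P (P^2 - 2*Q)" 
      by (rule coprime_add_multI[where k = P]) (simp add: power2_eq_square)
    then obtain e u v where e: "e = 1 \<or> e = -1" and u: "P = e * u^2" and v: "P^2 - 2*Q = e * v^2"
      using c by (rule coprime_mult_eq_squareE)
    have "odd u" using u False by auto
    moreover have "odd v" 
    proof
      assume "even v"
      then have "even (P^2 - 2*Q)" unfolding v by simp
      then show False using False by simp
    qed
    moreover have "P^2 = u^4" using u e by auto
    then have "2 * Q = u^4 - e * v^2" using v by linarith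
    then have "rat_of_int Q = 1/2 * rat_of_int (u^4 - e * v^2)"
      by (rule half_rat_of_int)
    ultimately have "P = e * u^2 \<and> rat_of_int Q = 1/2 * rat_of_int (u^4 - e * v^2) \<and> odd (u * v)"
      using u by (intro conjI) simp_all
    then show ?thesis using e by blast
  next
    case True
    then obtain p where p: "P = 2 * p" by auto
    have Q: "odd Q" using cop True by (metis coprime_common_divisor odd_one)
    have "c^2 = 4 * (p * (2*p^2 - Q))" using c p by (simp add: power2_eq_square algebra_simps)
    then have "even (c^2)" by simp
    then have "even c" by simp
    then obtain d where "c = 2 * d" by auto
    then have d: "p * (2*p^2 - Q) = d^2" using \<open>c^2 = _\<close> by (simp add: power2_eq_square)
    have "coprime p (2*p^2 - Q)"
    proof (rule coprime_add_multI)
      show "coprime p (-Q)" using cop p by simp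
      show "2*p^2 - Q = (2*p) * p + -Q" by (simp add: power2_eq_square)
    qed
    then obtain e u v where e: "e = 1 \<or> e = -1" and u: "p = e * u^2" and v: "2*p^2 - Q = e * v^2"
      using d by (rule coprime_mult_eq_squareE)
    have "odd (e * v^2)" unfolding v[symmetric] using Q by simp
    then have "odd v" by auto
    moreover have "p^2 = u^4" using u e by auto
    then have "Q = 2 * u^4 - e * v^2" using v by linarith
    ultimately have "P = 2 * e * u^2 \<and> Q = 2 * u^4 - e * v^2 \<and> odd v"
      using u p by (intro conjI) simp_all
    then show ?thesis using e by blast
  qed
next
  assume ?R
  then obtain e a b :: int where e: "e \<in> {1,-1}" and ab:
    "(P = e * a^2 \<and> rat_of_int Q = 1/2 * rat_of_int (a^4 - e * b^2) \<and> odd (a * b))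
          \<or> (P = 2 * e * a^2 \<and> Q = 2 * a^4 - e * b^2 \<and> odd b)" by blast
  from ab show "is_square (lucas_U P Q 4)"
  proof
    assume *: "P = e * a^2 \<and> rat_of_int Q = 1/2 * rat_of_int (a^4 - e * b^2) \<and> odd (a * b)"
    then have "rat_of_int (2 * Q) = rat_of_int (a^4 - e * b^2)" by simp
    then have "2 * Q = a^4 - e * b^2" by (simp only: of_int_eq_iff)
    moreover have "P^2 = a^4" using * e by auto
    ultimately have "P^2 - 2*Q = e * b^2" by simp
    then have "P * (P^2 - 2*Q) = (a*b)^2" using * e by (auto simp: power_mult_distrib)
    then show ?thesis by (auto simp: lucas_U_4 is_square_iff)
  next
    assume *: "P = 2 * e * a^2 \<and> Q = 2 * a^4 - e * b^2 \<and> odd b"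
    moreover have "P^2 = 4 * a^4" using * e by (auto simp: power_mult_distrib)
    ultimately have "P^2 - 2*Q = 2 * e * b^2" by simp
    then have "P * (P^2 - 2*Q) = (2*a*b)^2" using * e by (auto simp: power_mult_distrib)
    then show ?thesis unfolding lucas_U_4 is_square_iff by blast
  qed
qed

section \<open>Squares among U_5: factoring five times a fourth power\<close>

lemma is_square_mult_cancel:
  fixes k x y :: int
  assumes "k \<noteq> 0" "k^2 * x = y^2"
  obtains z where "x = z^2" "y = k * z"
proof -
  have "k^2 dvd y^2" using assms(2) by (metis dvd_triv_left)
  then have "k dvd y" by (simp add: pow_divides_pow_iff)
  then obtain z where z: "y = k * z" by blast
  then have "x = z^2" using assms by (simp add: power_mult_distrib)
  with z that show thesis by blast
qed

lemma coprime_int_primeI: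
  fixes a b :: int
  assumes "a \<noteq> 0" "\<And>q. prime q \<Longrightarrow> q dvd a \<Longrightarrow> q dvd b \<Longrightarrow> False"
  shows "coprime a b"
proof (rule ccontr)
  assume "\<not> coprime a b"
  then have "\<not> is_unit (gcd a b)" by (simp add: coprime_iff_gcd_eq_1)
  then obtain q where "prime q" "q dvd gcd a b"
    using prime_divisor_exists[of "gcd a b"] assms(1) by auto
  then show False using assms(2)[of q] by simp
qed

text \<open>Dividing \<open>A\<close> by 5 leaves a product of coprime factors that is a fourth
  power. Only the sum \<open>A + B\<close> is recorded: it determines \<open>Q\<close> later on, and
  being symmetric it lets the case \<open>5 dvd B\<close> follow by exchanging the factors.\<close>

lemma coprime_mult_eq_five_fourth_power_aux:
  fixes A B p :: int
  assumes "coprime A B" "A * B = 5 * p ^ 4" "5 dvd A"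
  obtains e u v where "e = 1 \<or> e = -1" "coprime u v" "\<not> 5 dvd v" "p = u * v" 
    "A + B = e * (5 * u ^ 4 + v ^ 4)"
proof -
  obtain A' where A': "A = 5 * A'" using assms(3) by blast
  have "A' * B = p ^ 4" using assms(2) A' by simp
  have "coprime A' B" using assms(1) A' by simp
  have "\<not> 5 dvd B"
  proof
    assume "5 dvd B"
    then have "is_unit (5::int)" using assms(1,3) by (rule coprime_common_divisor[rotated 2])
    then show False by simp
  qed
  obtain e u v where e: "e = 1 \<or> e = -1" and u: "A' = e * u ^ 4" and v: "B = e * v ^ 4"
    using \<open>coprime A' B\<close> \<open>A' * B = p ^ 4\<close> by (rule coprime_mult_eq_fourth_powerE)
  have "coprime (u ^ 4) (v ^ 4)" using e \<open>coprime A' B\<close> unfolding u v by auto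
  then have cop: "coprime u v" by simp
  have "(p^2)^2 = ((u * v)^2)^2"
    using e \<open>A' * B = p ^ 4\<close> unfolding u v by (auto simp: power_mult_distrib)
  then have "p^2 = (u * v)^2" by (rule power2_eq_imp_eq) simp_all
  \<comment> \<open>Only even powers of \<open>p\<close> are known, so its sign is still open;
    replacing \<open>u\<close> by \<open>-u\<close> absorbs it.\<close>
  then have p: "p = u * v \<or> p = (-u) * v" by (auto simp: power2_eq_iff)
  have "\<not> 5 dvd v" 
  proof
    assume "5 dvd v"
    then have "5 dvd e * v ^ 4" by (simp add: numeral_eq_Suc)
    then show False using \<open>\<not> 5 dvd B\<close> v by simp
  qed
  have sum: "A + B = e * (5 * u ^ 4 + v ^ 4)" unfolding A' u v by (simp add: algebra_simps)
  from p show thesis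
  proof
    assume "p = u * v"
    then show thesis using that e cop \<open>\<not> 5 dvd v\<close> sum by blast
  next
    assume "p = (-u) * v"
    moreover have "coprime (-u) v" using cop by simp
    moreover have "A + B = e * (5 * (-u) ^ 4 + v ^ 4)" using sum by simp
    ultimately show thesis using that e \<open>\<not> 5 dvd v\<close> by blast
  qed
qed

lemma coprime_mult_eq_five_fourth_powerE:
  fixes A B p :: int
  assumes "coprime A B" "A * B = 5 * p ^ 4"
  obtains e u v where "e = 1 \<or> e = -1" "coprime u v" "\<not> 5 dvd v" "p = u * v" 
    "A + B = e * (5 * u ^ 4 + v ^ 4)"
proof -
  have "5 dvd A * B" using assms(2) by simp
  moreover have "prime (5::int)" by simp
  ultimately have "5 dvd A \<or> 5 dvd B" by (simp only: prime_dvd_mult_iff)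
  then show thesis
  proof
    assume "5 dvd A"
    with assms show thesis by (rule coprime_mult_eq_five_fourth_power_aux) (rule that)
  next
    assume "5 dvd B"
    moreover have "coprime B A" using assms(1) by (simp add: coprime_commute)
    moreover have "B * A = 5 * p ^ 4" using assms(2) by (simp only: mult.commute)
    ultimately show thesis 
      by (rule_tac coprime_mult_eq_five_fourth_power_aux[of B A p]) (simp_all add: add.commute that)
  qed
qed

text \<open>Otherwise \<open>q * q\<close>, which divides the product, would have to divide the
  squarefree number 5.\<close>

lemma prime_dvd_if_five_fourth_power:
  fixes A B p q :: int
  assumes "prime q" "q dvd A" "q dvd B" "A * B = 5 * p ^ 4"
  shows "q dvd p"
proof (rule ccontr)
  assume "\<not> q dvd p"
  then have "coprime q p" using assms(1) by (simp add: prime_imp_coprime)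
  then have "coprime (q * q) (p ^ 4)" by (simp add: coprime_mult_left_iff)
  moreover have "q * q dvd 5 * p ^ 4" using assms(2-4) by (metis mult_dvd_mono)
  ultimately have q5: "q * q dvd 5" by (simp add: coprime_dvd_mult_left_iff)
  have "q \<ge> 2" using assms(1) by (rule prime_ge_2_int)
  moreover have "q < 3"
  proof (rule ccontr)
    assume "\<not> q < 3"
    then have "3 * 3 \<le> q * q" by (intro mult_mono) auto
    then show False using zdvd_imp_le[OF q5] by simp
  qed
  ultimately have "q = 2" by simp
  then show False using q5 by simp
qed

text \<open>Completing the square turns the hypothesis into
  \<open>(2*Q - 3*P^2)^2 - (2*c)^2 = 5 * P^4\<close>, a difference of squares whose two factors
  multiply to five times a fourth power. For even \<open>P\<close> both factors must first be
  divided by 4. A common prime of the resulting factors divides \<open>P\<close> and then also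
  \<open>Q\<close>, so they are coprime.\<close>

lemma lucas_U_5_square_witness:
  fixes P Q :: int
  assumes P0: "P \<noteq> 0" and cop: "coprime P Q" and c: "P^4 - 3*P^2*Q + Q^2 = c^2"
  obtains a b e :: int where "coprime a b" "a \<noteq> 0" "b \<noteq> 0" "\<not> 5 dvd b" "e = 1 \<or> e = -1"
    "even a \<noteq> even b \<and> P = 2*a*b \<and> Q = e * (5*a^4 + b^4) + 6*a^2*b^2 \<or>
     odd a \<and> odd b \<and> P = a*b \<and> 4*Q = e * (5*a^4 + b^4) + 6*a^2*b^2"
proof (cases "even P")
  case True
  then obtain p where p: "P = 2 * p" by auto
  have Q: "odd Q" using cop True by (metis coprime_common_divisor odd_one)
  have "coprime p Q" using cop p by simp
  define w where "w = Q - 6*p^2"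
  have w: "w^2 - c^2 = 20 * p^4"
    unfolding c[symmetric] w_def p by (simp add: power2_eq_square power4_eq_xxxx algebra_simps)
  have "odd w" using Q by (simp add: w_def)
  have "even (w^2 - c^2)" using w by simp
  then have "odd c" using \<open>odd w\<close> by simp
  have "even (w - c)" "even (w + c)" using \<open>odd w\<close> \<open>odd c\<close> by auto
  then obtain A B where A: "w - c = 2 * A" and B: "w + c = 2 * B" by (meson evenE)
  have "4 * (A * B) = (w - c) * (w + c)" using A B by simp
  also have "\<dots> = 20 * p^4" using w by (simp add: power2_eq_square algebra_simps)
  finally have AB: "A * B = 5 * p^4" by simp
  have wAB: "A + B = w" using A B by simp
  have "coprime A B"
  proof (rule coprime_int_primeI)
    show "A \<noteq> 0" using AB P0 p by auto
  next
    fix q :: int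
    assume q: "prime q" "q dvd A" "q dvd B"
    then have qw: "q dvd w" unfolding wAB[symmetric] by simp
    have "q dvd p" using q \<open>A * B = 5 * p ^ 4\<close> by (rule prime_dvd_if_five_fourth_power)
    then have "q dvd w + 6 * p^2" using qw by (simp add: power2_eq_square)
    then have "q dvd Q" by (simp add: w_def)
    then show False using \<open>coprime p Q\<close> \<open>q dvd p\<close> q(1) by (metis coprime_common_divisor not_prime_unit)
  qed
  then obtain e u v where e: "e = 1 \<or> e = -1" and uv: "coprime u v" "\<not> 5 dvd v" and puv: "p = u * v"
    and sum: "A + B = e * (5 * u ^ 4 + v ^ 4)"
    using AB by (rule coprime_mult_eq_five_fourth_powerE)
  have "odd (e * (5 * u ^ 4 + v ^ 4))" using \<open>odd w\<close> sum wAB by simp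
  then have "even u \<noteq> even v" by auto
  moreover have "P = 2 * u * v" using p puv by simp
  moreover have "Q = e * (5*u^4 + v^4) + 6*u^2*v^2"
    using w_def wAB sum puv by (simp add: power_mult_distrib)
  moreover have "u \<noteq> 0" "v \<noteq> 0" using P0 p puv by auto
  ultimately show thesis using that e uv by blast
next
  case False
  define W where "W = 2*Q - 3*P^2"
  define A where "A = W - 2 * c"
  define B where "B = W + 2 * c"
  have "A * B = 5 * P^4"
  proof -
    have "A * B = W^2 - 4 * c^2" by (simp add: A_def B_def power2_eq_square algebra_simps)
    then show ?thesis
      unfolding c[symmetric] W_def by (simp add: power2_eq_square power4_eq_xxxx algebra_simps)
  qed
  have "odd A" using False by (simp add: A_def W_def)
  have "coprime A B"
  proof (rule coprime_int_primeI)
    show "A \<noteq> 0" using \<open>odd A\<close> by auto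
  next
    fix q :: int
    assume q: "prime q" "q dvd A" "q dvd B"
    have "q \<noteq> 2" using \<open>odd A\<close> q(2) by auto
    moreover have "prime (2::int)" by simp
    ultimately have q2: "\<not> q dvd 2" using q(1) primes_dvd_imp_eq by blast
    have "q dvd A + B" using q by simp
    then have "q dvd 2 * W" by (simp add: A_def B_def)
    then have qw: "q dvd W" using q(1) q2 by (simp add: prime_dvd_mult_iff)
    have "q dvd P" using q \<open>A * B = 5 * P ^ 4\<close> by (rule prime_dvd_if_five_fourth_power)
    then have "q dvd W + 3 * P^2" using qw by (simp add: power2_eq_square)
    then have "q dvd 2 * Q" by (simp add: W_def)
    then have "q dvd Q" using q(1) q2 by (simp add: prime_dvd_mult_iff)
    then show False using cop \<open>q dvd P\<close> q(1) by (metis coprime_common_divisor not_prime_unit)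
  qed
  then obtain e u v where e: "e = 1 \<or> e = -1" and uv: "coprime u v" "\<not> 5 dvd v" and puv: "P = u * v"
    and sum: "A + B = e * (5 * u ^ 4 + v ^ 4)"
    using \<open>A * B = _\<close> by (rule coprime_mult_eq_five_fourth_powerE)
  have "odd u" "odd v" using False puv by auto
  moreover have "4 * Q = e * (5*u^4 + v^4) + 6*u^2*v^2"
  proof -
    have "4 * Q = A + B + 6 * P^2" by (simp add: A_def B_def W_def)
    then show ?thesis using sum puv by (simp add: power_mult_distrib)
  qed
  moreover have "u \<noteq> 0" "v \<noteq> 0" using P0 puv by auto
  ultimately show thesis using that e uv puv by blast
qed

theorem lucas_U_5_square_iff:
  fixes P Q :: int
  assumes P0: "P \<noteq> 0" and cop: "coprime P Q"
  shows "is_square (lucas_U P Q 5) \<longleftrightarrow>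
        (\<exists>a b :: int. coprime a b \<and> a \<noteq> 0 \<and> b \<noteq> 0 \<and> \<not> 5 dvd b \<and>
           ((even a \<noteq> even b \<and>
               ((P, Q) = (2 * a * b, 5 * a^4 + 6 * a^2 * b^2 + b^4)
              \<or> (P, Q) = (2 * a * b, - 5 * a^4 + 6 * a^2 * b^2 - b^4)))
          \<or> (odd a \<and> odd b \<and>
               ((P, rat_of_int Q) =
                  (a * b, 1/4 * rat_of_int (5 * a^4 + 6 * a^2 * b^2 + b^4))
              \<or> (P, rat_of_int Q) =
                  (a * b, 1/4 * rat_of_int (- 5 * a^4 + 6 * a^2 * b^2 - b^4))))))"
    (is "_ \<longleftrightarrow> ?R")
proof -
  have quarter: "rat_of_int Q = 1/4 * rat_of_int k \<longleftrightarrow> 4 * Q = k" for k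
  proof -
    have "rat_of_int Q = 1/4 * rat_of_int k \<longleftrightarrow> rat_of_int (4 * Q) = rat_of_int k" by auto
    then show ?thesis by (simp only: of_int_eq_iff)
  qed
  \<comment> \<open>The sign \<open>e\<close> merges the two alternatives of each parity.\<close>
  have R: "?R \<longleftrightarrow> (\<exists>a b e :: int. coprime a b \<and> a \<noteq> 0 \<and> b \<noteq> 0 \<and> \<not> 5 dvd b \<and> (e = 1 \<or> e = -1) \<and>
    (even a \<noteq> even b \<and> P = 2*a*b \<and> Q = e * (5*a^4 + b^4) + 6*a^2*b^2 \<or>
     odd a \<and> odd b \<and> P = a*b \<and> 4*Q = e * (5*a^4 + b^4) + 6*a^2*b^2))" (is "_ \<longleftrightarrow> ?S")
  proof -
    have *: "1 * (5*a^4 + b^4) + 6*a^2*b^2 = 5 * a^4 + 6 * a^2 * b^2 + b^4" 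
      "(-1) * (5*a^4 + b^4) + 6*a^2*b^2 = - 5 * a^4 + 6 * a^2 * b^2 - b^4" for a b :: int
      by simp_all
    show ?thesis unfolding prod.inject quarter *[symmetric] by blast
  qed
  show ?thesis unfolding R
  proof
    assume "is_square (lucas_U P Q 5)"
    then obtain c where c: "P^4 - 3*P^2*Q + Q^2 = c^2" unfolding lucas_U_5 is_square_iff by blast
    obtain a b e :: int where "coprime a b" "a \<noteq> 0" "b \<noteq> 0" "\<not> 5 dvd b" "e = 1 \<or> e = -1"
      "even a \<noteq> even b \<and> P = 2*a*b \<and> Q = e * (5*a^4 + b^4) + 6*a^2*b^2 \<or>
       odd a \<and> odd b \<and> P = a*b \<and> 4*Q = e * (5*a^4 + b^4) + 6*a^2*b^2"
      by (rule lucas_U_5_square_witness[OF P0 cop c])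
    then show ?S by blast
  next
    assume ?S
    then obtain a b e :: int where e: "e = 1 \<or> e = -1" and 
      ab: "P = 2*a*b \<and> Q = e * (5*a^4 + b^4) + 6*a^2*b^2 \<or>
       P = a*b \<and> 4*Q = e * (5*a^4 + b^4) + 6*a^2*b^2" by blast
    \<comment> \<open>With \<open>x = 5*a^4\<close> and \<open>y = b^4\<close>, substitution below
      produces \<open>(x + y)^2 - 4*x*y = (x - y)^2\<close> up to a constant square factor.\<close>
    have id: "4 * (P^4 - 3*P^2*Q + Q^2) = (2 * Q - 3 * P^2)^2 - 5 * P^4"
      by (simp add: power2_eq_square power4_eq_xxxx algebra_simps)
    have e2: "(e * x)^2 = x^2" for x using e by auto
    from ab show "is_square (lucas_U P Q 5)"
    proof
      assume *: "P = 2*a*b \<and> Q = e * (5*a^4 + b^4) + 6*a^2*b^2"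
      then have "2 * Q - 3 * P^2 = e * (2 * (5*a^4 + b^4))" by (simp add: power_mult_distrib)
      then have "4 * (P^4 - 3*P^2*Q + Q^2) = (2 * (5*a^4 + b^4))^2 - 5 * (2*a*b)^4" 
        unfolding id using * e2 by simp
      also have "\<dots> = 4 * (5*a^4 - b^4)^2" by (simp add: power2_eq_square power4_eq_xxxx algebra_simps)
      finally have "P^4 - 3*P^2*Q + Q^2 = (5*a^4 - b^4)^2" by simp
      then show ?thesis unfolding lucas_U_5 is_square_iff by blast
    next
      assume *: "P = a*b \<and> 4*Q = e * (5*a^4 + b^4) + 6*a^2*b^2"
      then have "2 * (2 * Q - 3 * P^2) = e * (5*a^4 + b^4)" by (simp add: power_mult_distrib)
      then have "(2 * (2 * Q - 3 * P^2))^2 = (5*a^4 + b^4)^2" using e2 by (simp only:)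
      moreover have "16 * (P^4 - 3*P^2*Q + Q^2) = (2 * (2 * Q - 3 * P^2))^2 - 20 * P^4"
        using id by (simp add: power2_eq_square algebra_simps)
      ultimately have "16 * (P^4 - 3*P^2*Q + Q^2) = (5*a^4 + b^4)^2 - 20 * (a*b)^4" 
        using * by (simp only:)
      also have "\<dots> = (5*a^4 - b^4)^2" by (simp add: power2_eq_square power4_eq_xxxx algebra_simps)
      finally have sq: "16 * (P^4 - 3*P^2*Q + Q^2) = (5*a^4 - b^4)^2" .
      then have "4^2 * (P^4 - 3*P^2*Q + Q^2) = (5*a^4 - b^4)^2" by simp
      then obtain k where "P^4 - 3*P^2*Q + Q^2 = k^2" by (rule is_square_mult_cancel[rotated]) simp_all
      then show ?thesis unfolding lucas_U_5 is_square_iff by blast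
    qed
  qed
qed

section \<open>Squares among U_6: sign patterns of three nearly coprime factors\<close>

lemma nonneg_sum_neg_square:
  fixes a b d :: int
  assumes "a \<noteq> 0" "k > 0"
  shows "- (3 * b^2) - k * a^4 \<noteq> d^2" "- (b^2) - k * a^4 \<noteq> d^2"
proof -
  have "k * a^4 > 0" using assms by simp
  moreover have "b^2 \<ge> 0" "d^2 \<ge> 0" by simp_all
  ultimately show "- (3 * b^2) - k * a^4 \<noteq> d^2" "- (b^2) - k * a^4 \<noteq> d^2" by linarith+
qed

text \<open>With \<open>X = P\<^sup>2 - Q\<close> one has \<open>P\<^sup>2 - 3 Q = 3 X - 2 P\<^sup>2\<close>.\<close>

lemma square_factor_cases_not_3_dvd:
  fixes P X c :: int
  assumes cop: "coprime P X" and P0: "P \<noteq> 0" and P3: "\<not> 3 dvd P"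
    and sq: "P * (X * (3 * X - 2 * P^2)) = c^2"
  shows "\<exists>a b :: int. (P = a^2 \<and> X = b^2 \<and> is_square (- 2 * a^4 + 3 * b^2))
          \<or> (P = a^2 \<and> X = - 2 * b^2 \<and> is_square (a^4 + 3 * b^2))
          \<or> (P = - (a^2) \<and> X = 2 * b^2 \<and> is_square (a^4 - 3 * b^2))"
proof -
  have cop3: "coprime P (3 * X)"
    using cop prime_imp_coprime[of 3 P] P3 by (simp add: coprime_mult_right_iff coprime_commute)
  have "coprime P (3 * X - 2 * P^2)" 
    using cop3 by (rule coprime_add_multI[where k = "-2*P"]) (simp add: power2_eq_square)
  then have "coprime P (X * (3 * X - 2 * P^2))" using cop by simp
  then obtain e a d where e: "e = 1 \<or> e = -1" and a: "P = e * a^2" and d: "X * (3 * X - 2 * P^2) = e * d^2"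
    using sq by (rule coprime_mult_eq_squareE)
  have e2: "e * (e * z) = z" for z using e by auto
  have P2: "P^2 = a^4" using a e by auto
  have a0: "a \<noteq> 0" using a P0 by auto
  have a3: "\<not> 3 dvd a" using P3 a by auto
  \<comment> \<open>Since \<open>a^4\<close> is 1 modulo 3, several sign patterns below would make
    \<open>y^2\<close> congruent to 2 modulo 3. Those with both terms negative fail by size.\<close>
  have "a^2 mod 3 = 1" using a3 by (simp add: square_mod_3)
  have "a^4 mod 3 = (a^2 mod 3)^2 mod 3" by (simp add: power_mod)
  then have a4: "a^4 mod 3 = 1" using \<open>a^2 mod 3 = 1\<close> by simp
  show ?thesis
  \<comment> \<open>As \<open>P\<close> is prime to \<open>X\<close>, a common divisor of
    \<open>X\<close> and \<open>3 * X - 2 * P^2\<close> divides 2. For even \<open>X\<close> the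
    factor 2 is taken out of both.\<close>
  proof (cases "even X")
    case False
    have "coprime X (3 * X - 2 * P^2)"
    proof (rule coprime_add_multI[where k = 3])
      show "coprime X (- 2 * P^2)" using cop False by (simp add: coprime_commute)
    qed simp
    then have "coprime X (e * (3 * X - 2 * P^2))" using e by auto
    moreover have "X * (e * (3 * X - 2 * P^2)) = d^2"
      unfolding mult.left_commute[of X e] d by (rule e2)
    ultimately obtain h b y where h: "h = 1 \<or> h = -1" and b: "X = h * b^2" 
      and y': "e * (3 * X - 2 * P^2) = h * y^2"
      by (rule coprime_mult_eq_squareE)
    have y: "3 * X - 2 * a^4 = e * h * y^2"
      using y' e2[of "3 * X - 2 * P^2"] P2 by (simp only: mult.assoc)
    consider "e = 1" "h = 1" | "h = -1" "e = 1" | "h = 1" "e = -1" | "h = -1" "e = -1" using e h by blast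
    then show ?thesis
    proof cases
      case 1
      then have "P = a^2" "X = b^2" "- 2 * a^4 + 3 * b^2 = y^2" using a b y by auto
      then show ?thesis unfolding is_square_iff by blast
    next
      case 2
      then have "2 * a^4 + 3 * b^2 = y^2" using b y by auto
      then have "y^2 mod 3 = 2" using a4 by presburger
      then show ?thesis by (simp add: square_mod_3 split: if_splits)
    next
      case 3
      then have "2 * a^4 - 3 * b^2 = y^2" using b y by auto
      then have "y^2 mod 3 = 2" using a4 by presburger
      then show ?thesis by (simp add: square_mod_3 split: if_splits)
    next
      case 4
      then have "- (3 * b^2) - 2 * a^4 = y^2" using b y by auto
      then show ?thesis using nonneg_sum_neg_square(1)[OF a0, of 2 b y] by simp
    qed
  next
    case True
    then obtain x where x: "X = 2 * x" by auto
    have copPx: "coprime P x" using cop x by simp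
    have "X * (3 * X - 2 * P^2) = 2^2 * (x * (3 * x - P^2))" using x by (simp add: algebra_simps)
    then have "2^2 * (e * (x * (3 * x - P^2))) = d^2" 
      using d e2[of "d^2"] by (simp only: mult.left_commute)
    then obtain d' where d': "e * (x * (3 * x - P^2)) = d'^2" 
      by (rule is_square_mult_cancel[rotated]) simp_all
    have "coprime x (3 * x - P^2)"
    proof (rule coprime_add_multI[where k = 3])
      show "coprime x (- (P^2))" using copPx by (simp add: coprime_commute)
    qed simp
    then have "coprime x (e * (3 * x - P^2))" using e by auto
    moreover have "x * (e * (3 * x - P^2)) = d'^2" using d' by (simp add: mult_ac)
    ultimately obtain h b y where h: "h = 1 \<or> h = -1" and b: "x = h * b^2" 
      and y': "e * (3 * x - P^2) = h * y^2"
      by (rule coprime_mult_eq_squareE)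
    have y: "3 * x - a^4 = e * h * y^2"
      using y' e2[of "3 * x - P^2"] P2 by (simp only: mult.assoc)
    consider "e = 1" "h = 1" | "h = -1" "e = 1" | "h = 1" "e = -1" | "h = -1" "e = -1" using e h by blast
    then show ?thesis
    proof cases
      case 1
      then have "3 * b^2 - a^4 = y^2" using b y by auto
      then have "y^2 mod 3 = 2" using a4 by presburger
      then show ?thesis by (simp add: square_mod_3 split: if_splits)
    next
      case 2
      then have "P = a^2" "X = - 2 * b^2" "a^4 + 3 * b^2 = y^2" using a b x y by auto
      then show ?thesis unfolding is_square_iff by blast
    next
      case 3
      then have "P = - (a^2)" "X = 2 * b^2" "a^4 - 3 * b^2 = y^2" using a b x y by auto
      then show ?thesis unfolding is_square_iff by blast
    next
      case 4
      then have "- (3 * b^2) - 1 * a^4 = y^2" using b y by auto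
      then show ?thesis using nonneg_sum_neg_square(1)[OF a0, of 1 b y] by simp
    qed
  qed
qed

text \<open>With \<open>P = 3 * p\<close> a factor 9 leaves the product, while \<open>X\<close> is
  prime to 3. The pattern \<open>e = -1\<close> always fails, so \<open>P\<close> is three times a
  square. The sign \<open>h\<close> that remains free gives \<open>\<delta> = h\<close> for odd
  \<open>X\<close> and \<open>\<delta> = 2 * h\<close> for even \<open>X\<close>.\<close>

lemma square_factor_cases_3_dvd:
  fixes P X c :: int
  assumes cop: "coprime P X" and P0: "P \<noteq> 0" and P3: "3 dvd P"
    and sq: "P * (X * (3 * X - 2 * P^2)) = c^2"
  shows "\<exists>a b :: int. \<exists>\<delta>\<in>{1, -1, 2, -2 :: int}.
               P = 3 * a^2 \<and> X = \<delta> * b^2 \<and> is_square (- (6 div \<delta>) * a^4 + b^2)"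
proof -
  obtain p where p: "P = 3 * p" using P3 by blast
  have copp: "coprime p X" and X3: "coprime 3 X" using cop p by simp_all
  have nX3: "\<not> 3 dvd X"
  proof
    assume "3 dvd X"
    then have "is_unit (3::int)" using X3 by (metis coprime_common_divisor dvd_refl)
    then show False by simp
  qed
  have "3^2 * (p * (X * (X - 6 * p^2))) = c^2" using sq p by (auto simp: algebra_simps power2_eq_square)
  then obtain c' where c': "p * (X * (X - 6 * p^2)) = c'^2" by (rule is_square_mult_cancel[rotated]) simp_all
  have "coprime p (X - 6 * p^2)" 
    using copp by (rule coprime_add_multI[where k = "-6*p"]) (simp add: power2_eq_square)
  then have "coprime p (X * (X - 6 * p^2))" using copp by simp
  then obtain e a d where e: "e = 1 \<or> e = -1" and a: "p = e * a^2" and d: "X * (X - 6 * p^2) = e * d^2"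
    using c' by (rule coprime_mult_eq_squareE)
  have e2: "e * (e * z) = z" for z using e by auto
  have p2: "p^2 = a^4" using a e by auto
  have a0: "a \<noteq> 0" using a p P0 by auto
  have no3: "\<not> 3 dvd b" if "X = h * b^2" for h b using nX3 that by (auto simp: power2_eq_square)
  \<comment> \<open>Because -1 is not a square modulo 3, a sum of two squares divisible by 3 has
    both terms divisible by 3.\<close>
  have sum3: "3 dvd b" if "k * a^4 - b^2 = y^2" "3 dvd k" for b y k :: int
  proof -
    have "3 dvd b^2 + y^2" 
    proof -
      have "b^2 + y^2 = k * a^4" using that(1) by simp
      then show ?thesis using that(2) by simp
    qed
    then have "(b^2 + y^2) mod 3 = 0" by simp
    moreover have "(b^2 + y^2) mod 3 = (b^2 mod 3 + y^2 mod 3) mod 3" by (simp add: mod_add_eq)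
    ultimately show ?thesis by (auto simp: square_mod_3 split: if_splits)
  qed
  show ?thesis
  proof (cases "even X")
    case False
    have "coprime X (X - 6 * p^2)"
    proof (rule coprime_add_multI[where k = 1])
      have "coprime X (2 * 3)" using X3 False
          by (simp only: coprime_mult_right_iff coprime_right_2_iff_odd coprime_commute simp_thms)
      moreover have "coprime X (p^2)" using copp by (simp add: coprime_commute)
      ultimately have "coprime X ((2 * 3) * p^2)" by (simp only: coprime_mult_right_iff simp_thms)
      then show "coprime X (- 6 * p^2)" by simp
    qed simp
    then have "coprime X (e * (X - 6 * p^2))" using e by auto
    moreover have "X * (e * (X - 6 * p^2)) = d^2"
      unfolding mult.left_commute[of X e] d by (rule e2)
    ultimately obtain h b y where h: "h = 1 \<or> h = -1" and b: "X = h * b^2" 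
      and y': "e * (X - 6 * p^2) = h * y^2"
      by (rule coprime_mult_eq_squareE)
    have y: "X - 6 * a^4 = e * h * y^2"
      using y' e2[of "X - 6 * p^2"] p2 by (simp only: mult.assoc)
    consider "e = 1" "h = 1" | "h = -1" "e = 1" | "h = 1" "e = -1" | "h = -1" "e = -1" using e h by blast
    then show ?thesis
    proof cases
      case 1
      then have "P = 3 * a^2" "X = 1 * b^2" "- (6 div 1) * a^4 + b^2 = y^2" using p a b y by auto
      then show ?thesis unfolding is_square_iff by blast
    next
      case 2
      then have "P = 3 * a^2" "X = (-1) * b^2" "- (6 div (-1)) * a^4 + b^2 = y^2" using p a b y by auto
      then show ?thesis unfolding is_square_iff by blast
    next
      case 3
      then have "6 * a^4 - b^2 = y^2" using b y by auto
      then show ?thesis using sum3[of 6 b y] no3[OF b] by simp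
    next
      case 4
      then have "- (b^2) - 6 * a^4 = y^2" using b y by auto
      then show ?thesis using nonneg_sum_neg_square(2)[OF a0, of 6 b y] by simp
    qed
  next
    case True
    then obtain x where x: "X = 2 * x" by auto
    have coppx: "coprime p x" using copp x by simp
    have "X * (X - 6 * p^2) = 2^2 * (x * (x - 3 * p^2))" using x by (simp add: algebra_simps)
    then have "2^2 * (e * (x * (x - 3 * p^2))) = d^2" 
      using d e2[of "d^2"] by (simp only: mult.left_commute)
    then obtain d' where d': "e * (x * (x - 3 * p^2)) = d'^2" 
      by (rule is_square_mult_cancel[rotated]) simp_all
    have "coprime x (x - 3 * p^2)"
    proof (rule coprime_add_multI[where k = 1])
      have "coprime x 3" using X3 x by (simp add: coprime_commute)
      moreover have "coprime x (p^2)" using coppx by (simp add: coprime_commute)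
      ultimately have "coprime x (3 * p^2)" by (simp only: coprime_mult_right_iff simp_thms)
      then show "coprime x (- 3 * p^2)" by simp
    qed simp
    then have "coprime x (e * (x - 3 * p^2))" using e by auto
    moreover have "x * (e * (x - 3 * p^2)) = d'^2" using d' by (simp add: mult_ac)
    ultimately obtain h b y where h: "h = 1 \<or> h = -1" and b: "x = h * b^2" 
      and y': "e * (x - 3 * p^2) = h * y^2"
      by (rule coprime_mult_eq_squareE)
    have y: "x - 3 * a^4 = e * h * y^2"
      using y' e2[of "x - 3 * p^2"] p2 by (simp only: mult.assoc)
    have b': "X = (2 * h) * b^2" using b x by simp
    consider "e = 1" "h = 1" | "h = -1" "e = 1" | "h = 1" "e = -1" | "h = -1" "e = -1" using e h by blast
    then show ?thesis
    proof cases
      case 1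
      then have "P = 3 * a^2" "X = 2 * b^2" "- (6 div 2) * a^4 + b^2 = y^2" using p a b x y by auto
      then show ?thesis unfolding is_square_iff by blast
    next
      case 2
      then have "P = 3 * a^2" "X = (-2) * b^2" "- (6 div (-2)) * a^4 + b^2 = y^2" using p a b x y by auto
      then show ?thesis unfolding is_square_iff by blast
    next
      case 3
      then have "3 * a^4 - b^2 = y^2" using b y by auto
      then show ?thesis using sum3[of 3 b y] no3[OF b'] by simp
    next
      case 4
      then have "- (b^2) - 3 * a^4 = y^2" using b y by auto
      then show ?thesis using nonneg_sum_neg_square(2)[OF a0, of 3 b y] by simp
    qed
  qed
qed

theorem lucas_U_6_square_iff:
  fixes P Q :: int
  assumes P0: "P \<noteq> 0" and cop: "coprime P Q"
  shows "is_square (lucas_U P Q 6) \<longleftrightarrow>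
        (\<exists>a b :: int.
            (P = a^2 \<and> P^2 - Q = b^2 \<and> is_square (- 2 * a^4 + 3 * b^2))
          \<or> (P = a^2 \<and> P^2 - Q = - 2 * b^2 \<and> is_square (a^4 + 3 * b^2))
          \<or> (P = - (a^2) \<and> P^2 - Q = 2 * b^2 \<and> is_square (a^4 - 3 * b^2))
          \<or> (\<exists>\<delta>\<in>{1, -1, 2, -2 :: int}.
               P = 3 * a^2 \<and> P^2 - Q = \<delta> * b^2 \<and> is_square (- (6 div \<delta>) * a^4 + b^2)))"
    (is "_ \<longleftrightarrow> (\<exists>a b. ?R a b)")
proof -
  define X where "X = P^2 - Q"
  have "coprime P X"
    unfolding X_def by (rule coprime_add_multI[where b = "-Q" and k = P])
      (use cop in \<open>simp_all add: power2_eq_square\<close>)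
  have U: "lucas_U P Q 6 = P * (X * (3 * X - 2 * P^2))" unfolding lucas_U_6 X_def by (simp add: mult_ac)
  show ?thesis
  proof
    assume "is_square (lucas_U P Q 6)"
    then obtain c where c: "P * (X * (3 * X - 2 * P^2)) = c^2" unfolding U is_square_iff by blast
    show "\<exists>a b. ?R a b"
      using square_factor_cases_not_3_dvd[OF \<open>coprime P X\<close> P0 _ c]
        square_factor_cases_3_dvd[OF \<open>coprime P X\<close> P0 _ c]
      unfolding X_def by blast
  next
    assume "\<exists>a b. ?R a b"
    then obtain a b where ab: "?R a b" by blast
    have "\<exists>y. P * (X * (3 * X - 2 * P^2)) = y^2"
    proof -
      consider (1) y where "P = a^2" "X = b^2" "- 2 * a^4 + 3 * b^2 = y^2"
        | (2) y where "P = a^2" "X = - 2 * b^2" "a^4 + 3 * b^2 = y^2"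
        | (3) y where "P = - (a^2)" "X = 2 * b^2" "a^4 - 3 * b^2 = y^2"
        | (4) \<delta> y
            where "\<delta> \<in> {1, -1, 2, -2}" "P = 3 * a^2" "X = \<delta> * b^2" "- (6 div \<delta>) * a^4 + b^2 = y^2"
        using ab unfolding X_def[symmetric] is_square_iff by blast
      then show ?thesis
      proof cases
        case 1
        then have Z: "3 * X - 2 * P^2 = y^2" by simp
        have "P * (X * (3 * X - 2 * P^2)) = (a * b * y)^2"
          by (subst Z) (simp add: 1(1,2) power2_eq_square)
        then show ?thesis by blast
      next
        case 2
        then have Z: "3 * X - 2 * P^2 = - 2 * y^2" by simp
        have "P * (X * (3 * X - 2 * P^2)) = (2 * a * b * y)^2"
          by (subst Z) (simp add: 2(1,2) power2_eq_square)
        then show ?thesis by blast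
      next
        case 3
        then have Z: "3 * X - 2 * P^2 = - 2 * y^2" by simp
        have "P * (X * (3 * X - 2 * P^2)) = (2 * a * b * y)^2"
          by (subst Z) (simp add: 3(1,2) power2_eq_square)
        then show ?thesis by blast
      next
        case 4
        \<comment> \<open>Each admissible \<delta> divides 6, so the integer division is
          exact.\<close>
        then have "3 * X - 2 * P^2 = 3 * \<delta> * (- (6 div \<delta>) * a^4 + b^2)"
          by (auto simp: power_mult_distrib)
        then have Z: "3 * X - 2 * P^2 = 3 * \<delta> * y^2" unfolding 4(4) .
        have "P * (X * (3 * X - 2 * P^2)) = (3 * \<delta> * a * b * y)^2" 
          by (subst Z) (simp add: 4(2,3) power2_eq_square)
        then show ?thesis by blast
      qed
    qed
    then show "is_square (lucas_U P Q 6)" unfolding U is_square_iff .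
  qed
qed

subsection \<open>The multiples of the base point\<close>

fun ell_neg :: "'a::field_char_0 ell_point \<Rightarrow> 'a ell_point" where
  "ell_neg Infinity = Infinity"
| "ell_neg (Affine x y) = Affine x (- y)"

lemma ell_neg_neg [simp]: "ell_neg (ell_neg p) = p"
  by (cases p) simp_all

lemma on_curve_ell_neg [simp]: "on_curve a b c (ell_neg p) \<longleftrightarrow> on_curve a b c p"
  by (cases p) simp_all

lemma ell_add_Infinity_right [simp]: "ell_add a b p Infinity = p"
  by (cases p) simp_all

lemma ell_add_commute:
  assumes "on_curve a b c p" "on_curve a b c q"
  shows "ell_add a b p q = ell_add a b q p"
proof (cases p)
  case (Affine x1 y1)
  show ?thesis
  proof (cases q)
    case q: (Affine x2 y2)
    show ?thesis
    proof (cases "x1 = x2")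
      case True
      then have "y1^2 = y2^2" using assms Affine q by simp
      then have "y1 = y2 \<or> y1 = - y2" by (simp add: power2_eq_iff)
      then show ?thesis using True Affine q by auto
    next
      case False
      define l where "l = (y2 - y1) / (x2 - x1)"
      have l': "(y1 - y2) / (x1 - x2) = l" using False 
        unfolding l_def by (metis minus_diff_eq minus_divide_divide)
      have "y2 = y1 + l * (x2 - x1)" using False by (simp add: l_def)
      then show ?thesis using False Affine q l'
        by (simp add: third_point_def Let_def l_def[symmetric] algebra_simps)
    qed
  qed (simp add: Affine)
qed simp

text \<open>Apart from the point at infinity and \<open>-P\<^sub>0 = (-1, -1)\<close>, a point is given by \<open>z = x + 1\<close> and
  the slope \<open>u\<close> of the line that joins it to \<open>P\<^sub>0 = (-1, 1)\<close>.\<close>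

definition slope_rel :: "'a::field_char_0 \<Rightarrow> 'a \<Rightarrow> bool" where
  "slope_rel z u \<longleftrightarrow> z^2 + (3 - u^2) * z - (4 + 2 * u) = 0"

definition slope_point :: "'a::field_char_0 \<Rightarrow> 'a \<Rightarrow> 'a ell_point" where
  "slope_point z u = Affine (z - 1) (1 + u * z)"

abbreviation on_E :: "'a::field_char_0 ell_point \<Rightarrow> bool" where
  "on_E \<equiv> on_curve 6 5 1"

abbreviation add_E :: "'a::field_char_0 ell_point \<Rightarrow> 'a ell_point \<Rightarrow> 'a ell_point" where
  "add_E \<equiv> ell_add 6 5"

abbreviation base_point :: "'a::field_char_0 ell_point" where
  "base_point \<equiv> Affine (-1) 1"

definition shift :: "'a::field_char_0 ell_point \<Rightarrow> 'a ell_point" where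
  "shift p = add_E base_point p"

lemma on_E_iff: "on_E (Affine (z - 1) y) \<longleftrightarrow> y^2 = z^3 + 3*z^2 - 4*z + 1"
proof -
  have "(z - 1)^3 + 6 * (z - 1)^2 + 5 * (z - 1) + 1 = z^3 + 3*z^2 - 4*z + 1"
    by (simp add: power2_eq_square power3_eq_cube algebra_simps)
  then show ?thesis by (simp only: on_curve.simps)
qed

lemma on_E_slope_point: "slope_rel z u \<Longrightarrow> on_E (slope_point z u)"
proof -
  assume "slope_rel z u"
  \<comment> \<open>Substituting \<open>y = 1 + u * z\<close> into the equation of the curve leaves
    \<open>z\<close> times the quadratic.\<close>
  then have "z * (z^2 + (3 - u^2) * z - (4 + 2 * u)) = 0" by (simp add: slope_rel_def)
  then show ?thesis unfolding slope_point_def on_E_iff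
    by (simp add: power2_eq_square power3_eq_cube algebra_simps)
qed

lemma on_E_cases:
  fixes p :: "'a::field_char_0 ell_point"
  assumes "on_E p"
  obtains "p = Infinity" | "p = ell_neg base_point" 
    | z u where "p = slope_point z u" "slope_rel z u"
proof (cases p)
  case (Affine x y)
  define z where "z = x + 1"
  have x: "x = z - 1" by (simp add: z_def)
  have y: "y^2 = z^3 + 3*z^2 - 4*z + 1" using assms unfolding Affine x on_E_iff .
  show thesis
  proof (cases "z = 0")
    case True
    then have "y = 1 \<or> y = -1" using y by (simp add: power2_eq_1_iff)
    then show thesis
    proof
      assume "y = 1"
      \<comment> \<open>At the base point itself the line is the tangent, whose slope is -2.\<close>
      then have "p = slope_point 0 (-2)" by (simp add: Affine x True slope_point_def)
      moreover have "slope_rel (0::'a) (-2)" by (simp add: slope_rel_def)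
      ultimately show thesis using that(3) by blast
    next
      assume "y = -1"
      then show thesis using that(2) by (simp add: Affine x True)
    qed
  next
    case False
    define u where "u = (y - 1) / z"
    have yu: "y = 1 + u * z" using False by (simp add: u_def)
    have "z * (z^2 + (3 - u^2) * z - (4 + 2 * u)) = 0" 
      using y unfolding yu by (simp add: power2_eq_square power3_eq_cube algebra_simps)
    then have "slope_rel z u" using False by (simp add: slope_rel_def)
    moreover have "p = slope_point z u" by (simp add: Affine x yu slope_point_def)
    ultimately show thesis using that(3) by blast
  qed
qed (rule that(1))

text \<open>The two roots of the quadratic \<open>slope_rel _ u\<close> have the sum \<open>u\<^sup>2 - 3\<close>.\<close>

lemma slope_rel_conjugate: "slope_rel z u \<Longrightarrow> slope_rel (u^2 - 3 - z) u"
  unfolding slope_rel_def by (simp add: power2_eq_square algebra_simps)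

text \<open>The line of slope \<open>u\<close> through the base point meets the curve again where
  \<open>z\<close> is a root of the quadratic. The sum is the reflection of the point at the other
  root. For \<open>z = 0\<close> the line is the tangent.\<close>

lemma shift_slope_point:
  assumes "slope_rel z u"
  shows "shift (slope_point z u) = ell_neg (slope_point (u^2 - 3 - z) u)"
proof (cases "z = 0")
  case True
  then have "2 * (u + 2) = 0" using assms by (simp add: slope_rel_def)
  then have "u = -2" by (simp only: mult_eq_0_iff eq_neg_iff_add_eq_0) simp
  then show ?thesis using True
    by (simp add: shift_def slope_point_def third_point_def Let_def)
next
  case False
  then show ?thesis 
    by (simp add: shift_def slope_point_def third_point_def Let_def algebra_simps power2_eq_square)
qed

lemma shift_Infinity [simp]: "shift Infinity = base_point"
  by (simp add: shift_def)

lemma shift_neg_base_point [simp]: "shift (Affine (-1) (-1)) = Infinity"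
  by (simp add: shift_def)

lemma on_E_shift: "on_E p \<Longrightarrow> on_E (shift p)"
  by (erule on_E_cases) (simp_all add: shift_slope_point slope_rel_conjugate on_E_slope_point)

text \<open>Adding the base point and then negating exchanges the two roots of the quadratic, hence
  is an involution. This is what provides an inverse of \<open>shift\<close> without group
  laws.\<close>

lemma neg_shift_neg_shift:
  assumes "on_E p"
  shows "ell_neg (shift (ell_neg (shift p))) = p"
  using assms by (rule on_E_cases) (simp_all add: shift_slope_point slope_rel_conjugate)

lemma shift_neg_shift:
  assumes "on_E p"
  shows "shift (ell_neg (shift p)) = ell_neg p"
  using neg_shift_neg_shift[OF assms] by (metis ell_neg_neg)

lemma third_point_neg: "third_point a (- l) x1 (- y1) x2 = ell_neg (third_point a l x1 y1 x2)"
  by (simp add: third_point_def Let_def)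

lemma ell_add_neg_neg: "ell_add a b (ell_neg p) (ell_neg q) = ell_neg (ell_add a b p q)"
proof (cases p)
  case p: (Affine x1 y1)
  show ?thesis
  proof (cases q)
    case q: (Affine x2 y2)
    show ?thesis
    proof (cases "x1 = x2")
      case True
      have "(3 * x2^2 + 2 * a * x2 + b) / (2 * - y1) = - ((3 * x2^2 + 2 * a * x2 + b) / (2 * y1))"
        by simp
      moreover have "- y1 = - (- y2) \<longleftrightarrow> y1 = - y2" by auto
      ultimately show ?thesis
        unfolding p q ell_neg.simps ell_add.simps True
            by (cases "y1 = - y2") (simp_all only: third_point_neg ell_neg.simps if_True if_False simp_thms)
    next
      case False
      have "(- y2 - - y1) / (x2 - x1) = - ((y2 - y1) / (x2 - x1))"
        by (simp add: minus_divide_left)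
      then show ?thesis
        unfolding p q ell_neg.simps ell_add.simps using False by (simp only: third_point_neg if_True simp_thms)
    qed
  qed (simp add: p)
qed simp

text \<open>Associativity with \<open>P\<^sub>0\<close> in the middle. If the slopes \<open>u\<^sub>1\<close> and \<open>u\<^sub>2\<close> differ then both sides
  have the \<open>z\<close>-coordinate \<open>s (s - u\<^sub>1 - u\<^sub>2)\<close>, where \<open>s = (z\<^sub>1 - z\<^sub>2) / (u\<^sub>1 - u\<^sub>2)\<close>.\<close>

lemma add_shift_slope_point:
  fixes z1 :: "'a::field_char_0"
  assumes r1: "slope_rel z1 u1" and r2: "slope_rel z2 u2" and u: "u1 \<noteq> u2" 
    and s: "s * (u1 - u2) = z1 - z2"
  defines "w \<equiv> u1^2 - 3 - z1"
  shows "add_E (shift (slope_point z1 u1)) (slope_point z2 u2) =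
    Affine (s * (s - u1 - u2) - 1) ((s - u1) * (w - s * (s - u1 - u2)) + 1 + u1 * w)"
proof -
  have sum: "third_point 6 (s - u1) (w - 1) (- (1 + u1 * w)) (z2 - 1) =
     Affine (s * (s - u1 - u2) - 1) ((s - u1) * (w - s * (s - u1 - u2)) + 1 + u1 * w)"
  proof -
    have "(s - u1)^2 - 6 - (w - 1) - (z2 - 1) = s * (s - u1 - u2) - 1"
    proof -
      have "(s - u1)^2 - 6 - (w - 1) - (z2 - 1) = s^2 - 2 * (s * u1) + (z1 - z2) - 1"
        by (simp add: w_def power2_eq_square algebra_simps)
      also have "\<dots> = s * (s - u1 - u2) - 1" 
        unfolding s[symmetric] by (simp add: power2_eq_square algebra_simps)
      finally show ?thesis .
    qed
    then show ?thesis by (simp add: third_point_def Let_def)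
  qed
  \<comment> \<open>Subtracting the two quadratics gives a relation that is free of the denominator
    \<open>z2 - w\<close>. It yields the chord slope \<open>s - u1\<close> when the abscissas differ
    and still carries information when they agree.\<close>
  have chord: "2 + (u1 + u2) * z2 = s * (z2 - w)"
  proof -
    have "(u1 - u2) * (2 + (u1 + u2) * z2) = (z1 - z2) * (z2 - w)"
    proof -
      have e1: "z1 * z1 = 4 + 2 * u1 + u1 * u1 * z1 - 3 * z1"
          and e2: "z2 * z2 = 4 + 2 * u2 + u2 * u2 * z2 - 3 * z2"
        using r1 r2 by (simp_all add: slope_rel_def power2_eq_square algebra_simps)
      have "(z1 - z2) * (z2 - w) = z1 * z1 - z2 * z2 + (3 - u1 * u1) * (z1 - z2)"
        by (simp add: w_def power2_eq_square algebra_simps)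
      also have "\<dots> = (u1 - u2) * (2 + (u1 + u2) * z2)" 
        unfolding e1 e2 by (simp add: algebra_simps)
      finally show ?thesis ..
    qed
    also have "\<dots> = (u1 - u2) * (s * (z2 - w))" unfolding s[symmetric] by (simp add: mult_ac)
    finally show ?thesis using u by simp
  qed
  have lhs: "add_E (shift (slope_point z1 u1)) (slope_point z2 u2) = 
    add_E (Affine (w - 1) (- (1 + u1 * w))) (Affine (z2 - 1) (1 + u2 * z2))"
    unfolding shift_slope_point[OF r1] by (simp add: slope_point_def w_def)
  show ?thesis
  proof (cases "w = z2")
    case False
    have "1 + u2 * z2 + (1 + u1 * w) = (s - u1) * (z2 - w)"
      using chord by (simp add: algebra_simps)
    then have "(1 + u2 * z2 + (1 + u1 * w)) / (z2 - w) = s - u1" using False by simp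
    then show ?thesis unfolding lhs sum[symmetric] using False by simp
  next
    case True
    \<comment> \<open>The abscissas agree. The relation then makes the two points equal, and
      \<open>u1 \<noteq> u2\<close> prevents them from being opposite. The sum is a doubling, and
      its tangent slope has to be identified with \<open>s - u1\<close> again.\<close>
    have c: "2 + (u1 + u2) * z2 = 0" using chord True by simp
    have "z2 \<noteq> 0" using c by auto
    have ne: "- (1 + u1 * w) \<noteq> - (1 + u2 * z2)" using True \<open>z2 \<noteq> 0\<close> u by simp
    have c': "u2 * z2 = - 2 - u1 * z2" 
    proof -
      have "u2 * z2 - (- 2 - u1 * z2) = 2 + (u1 + u2) * z2" by (simp add: algebra_simps)
      then show ?thesis using c by (simp only: right_minus_eq)
    qed
    then have eq: "- (1 + u1 * w) = 1 + u2 * z2" using True by (simp add: algebra_simps)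
    have "1 + u2 * z2 \<noteq> 0"
    proof
      assume "1 + u2 * z2 = 0"
      with eq ne show False by (simp only: minus_zero simp_thms)
    qed
    have rw: "slope_rel z2 u1" using slope_rel_conjugate[OF r1] True by (simp add: w_def)
    have z1: "z1 = u1^2 - 3 - z2" using True by (simp add: w_def algebra_simps)
    have tangent: "2 * - (1 + u1 * w) * (s - u1) = 3 * (w - 1)^2 + 2 * 6 * (w - 1) + 5"
    proof -
      have d: "z2 * (u1 - u2) = 2 * (1 + u1 * z2)"
      proof -
        have "z2 * (u1 - u2) = u1 * z2 - u2 * z2" by (simp add: algebra_simps)
        then show ?thesis unfolding c' by simp
      qed
      have "z2 * (z1 - z2) = s * (2 * (1 + u1 * z2))" unfolding d[symmetric] s[symmetric] by (simp add: mult_ac)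
      then have "2 * - (1 + u1 * z2) * (s - u1) = - z2 * (z1 - z2) + 2 * u1 * (1 + u1 * z2)"
        by (simp add: algebra_simps)
      also have "\<dots> = z2 * u1^2 + 3 * z2 + 2 * z2^2 + 2 * u1"
        unfolding z1 by (simp add: power2_eq_square algebra_simps)
      also have "\<dots> = 3 * (z2 - 1)^2 + 2 * 6 * (z2 - 1) + 5" 
      proof -
        have "z2 * u1^2 + 3 * z2 + 2 * z2^2 + 2 * u1 - (3 * (z2 - 1)^2 + 2 * 6 * (z2 - 1) + 5)
          = - (z2^2 + (3 - u1^2) * z2 - (4 + 2 * u1))"
          by (simp add: power2_eq_square algebra_simps)
        then show ?thesis using rw unfolding slope_rel_def by (simp only: minus_zero right_minus_eq)
      qed
      finally show ?thesis using True by simp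
    qed
    have slope: "(3 * (w - 1)^2 + 2 * 6 * (w - 1) + 5) / (2 * - (1 + u1 * w)) = s - u1"
    proof -
      have ne2: "2 * - (1 + u1 * w) \<noteq> 0" using \<open>1 + u2 * z2 \<noteq> 0\<close> unfolding eq
        by (metis mult_eq_0_iff zero_neq_numeral)
      show ?thesis using tangent nonzero_mult_div_cancel_left[OF ne2, of "s - u1"] by (simp only:)
    qed
    have "(w - 1 \<noteq> z2 - 1) = False" "(- (1 + u1 * w) = - (1 + u2 * z2)) = False"
      using True ne by simp_all
    then show ?thesis unfolding lhs sum[symmetric] ell_add.simps by (simp only: slope if_False)
  qed
qed

text \<open>For different slopes the explicit sum is symmetric in the two points. Equal slopes put
  both points on one line through the base point: either they coincide and commutativity suffices,
  or \<open>q\<close> is the negative of \<open>shift p\<close> and both sides are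
  \<open>Infinity\<close>. The two points without a slope are treated first.\<close>

lemma add_shift_left:
  fixes p q :: "'a::field_char_0 ell_point"
  assumes p: "on_E p" and q: "on_E q"
  shows "add_E (shift p) q = add_E p (shift q)"
proof -
  note comm = ell_add_commute[of 6 5 "1::'a"]
  have neg_base: "add_E (ell_neg base_point) (shift r) = r" if "on_E r" for r :: "'a ell_point"
  proof -
    have "add_E (ell_neg base_point) (shift r) = ell_neg (add_E base_point (ell_neg (shift r)))"
      unfolding ell_add_neg_neg[symmetric] by simp
    also have "\<dots> = r" using neg_shift_neg_shift[OF that] by (simp add: shift_def)
    finally show ?thesis .
  qed
  have base: "on_E (base_point :: 'a ell_point)" "on_E (ell_neg base_point :: 'a ell_point)" by simp_all
  show ?thesis
    using p
  proof (cases rule: on_E_cases)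
    case 1
    then show ?thesis by (simp add: shift_def)
  next
    case 2
    then show ?thesis using neg_base[OF q] by simp
  next
    case (3 z1 u1)
    note p3 = 3
    show ?thesis using q
    proof (cases rule: on_E_cases)
      case 1
      then show ?thesis using comm[OF p base(1)] by (simp add: shift_def)
    next
      case 2
      have "add_E (shift p) q = p" 
        using neg_base[OF p] comm[OF on_E_shift[OF p] base(2)] 2 by simp
      then show ?thesis using 2 by simp
    next
      case (3 z2 u2)
      show ?thesis
      proof (cases "u1 = u2")
        case False
        define s where "s = (z1 - z2) / (u1 - u2)"
        have s: "s * (u1 - u2) = z1 - z2" "s * (u2 - u1) = z2 - z1" 
          using False by (simp_all add: s_def field_simps)
        define v where "v = s * (s - u1 - u2)"
        have v': "s * (s - u2 - u1) = v" by (simp add: v_def algebra_simps)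
        have "add_E p (shift q) = add_E (shift q) p" by (rule comm[OF p on_E_shift[OF q]])
        also have "\<dots> = Affine (v - 1) ((s - u2) * (u2^2 - 3 - z2 - v) + 1 + u2 * (u2^2 - 3 - z2))"
          unfolding 3(1) p3(1) using add_shift_slope_point[OF 3(2) p3(2) _ s(2)] False v' by simp
        also have "(s - u2) * (u2^2 - 3 - z2 - v) + 1 + u2 * (u2^2 - 3 - z2) =
          (s - u1) * (u1^2 - 3 - z1 - v) + 1 + u1 * (u1^2 - 3 - z1)"
        proof -
          have "(s - u1) * (u1^2 - 3 - z1 - v) + 1 + u1 * (u1^2 - 3 - z1) 
            - ((s - u2) * (u2^2 - 3 - z2 - v) + 1 + u2 * (u2^2 - 3 - z2)) 
            = s * ((u1 - u2) * (u1 + u2) - (z1 - z2)) + (u1 - u2) * v"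
            by (simp add: power2_eq_square algebra_simps)
          also have "\<dots> = 0" unfolding s(1)[symmetric] v_def by (simp add: algebra_simps)
          finally show ?thesis by (simp only: right_minus_eq)
        qed
        also have "Affine (v - 1) \<dots> = add_E (shift p) q"
          unfolding 3(1) p3(1) v_def using add_shift_slope_point[OF p3(2) 3(2) False s(1)] by simp
        finally show ?thesis ..
      next
        case True
        show ?thesis
        proof (cases "z1 = z2")
          case True
          then show ?thesis using \<open>u1 = u2\<close> 3 p3 comm[OF on_E_shift[OF p] q] by simp
        next
          case False
          have "(z1 - z2) * (z1 + z2 + 3 - u1^2) = 0"
            using p3(2) 3(2) \<open>u1 = u2\<close> by (simp add: slope_rel_def power2_eq_square algebra_simps)
          then have "z1 + z2 + 3 - u1^2 = 0" using False by (simp only: mult_eq_0_iff right_minus_eq simp_thms)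
          moreover have "z2 - (u1^2 - 3 - z1) = z1 + z2 + 3 - u1^2" by (simp add: algebra_simps)
          ultimately have "z2 - (u1^2 - 3 - z1) = 0" by (simp only:)
          then have "z2 = u1^2 - 3 - z1" by (simp only: right_minus_eq)
          then have q': "q = ell_neg (shift p)" using 3 p3 \<open>u1 = u2\<close>
              by (simp add: shift_slope_point)
          have inv: "add_E r (ell_neg r) = Infinity" for r :: "'a ell_point" by (cases r) simp_all
          show ?thesis using inv[of p] inv[of "shift p"] shift_neg_shift[OF p] unfolding q' by simp
        qed
      qed
    qed
  qed
qed

text \<open>Integer multiples of the base point, built by iteration so that they are available
  before the points are known to form a group.\<close>

definition orbit_E :: "int \<Rightarrow> 'a::field_char_0 ell_point" where
  "orbit_E n = (if n \<ge> 0 then (shift ^^ nat n) Infinity else ell_neg ((shift ^^ nat (- n)) Infinity))"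

lemma on_E_funpow_shift: "on_E ((shift ^^ n) Infinity)"
  by (induction n) (simp_all add: on_E_shift)

lemma on_E_orbit [simp]: "on_E (orbit_E n)"
  by (simp add: orbit_E_def on_E_funpow_shift)

lemma orbit_E_0 [simp]: "orbit_E 0 = Infinity"
  by (simp add: orbit_E_def)

lemma orbit_E_uminus: "orbit_E (- n) = ell_neg (orbit_E n)"
  by (auto simp: orbit_E_def)

lemma shift_orbit_E: "shift (orbit_E n) = orbit_E (n + 1)"
proof (cases "n \<ge> 0")
  case True
  then have "nat (n + 1) = Suc (nat n)" by simp
  then show ?thesis using True by (simp add: orbit_E_def)
next
  case False
  define k where "k = nat (- n - 1)"
  have n: "n = - int (Suc k)" using False by (simp add: k_def)
  have "shift (orbit_E n) = shift (ell_neg (shift ((shift ^^ k) Infinity)))"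
    unfolding n orbit_E_uminus by (simp add: orbit_E_def nat_add_distrib)
  also have "\<dots> = ell_neg ((shift ^^ k) Infinity)"
    by (rule shift_neg_shift[OF on_E_funpow_shift])
  also have "\<dots> = orbit_E (- int k)" unfolding orbit_E_uminus by (simp add: orbit_E_def)
  also have "- int k = n + 1" by (simp add: n)
  finally show ?thesis .
qed

lemma orbit_E_1: "(orbit_E 1 :: 'a::field_char_0 ell_point) = base_point"
  using shift_orbit_E[of 0, where 'a = 'a] by simp

text \<open>Induction moves one copy of the base point at a time between the summands, by
  \<open>add_shift_left\<close>.\<close>

lemma orbit_E_add: "add_E (orbit_E m) (orbit_E n) = (orbit_E (m + n) :: 'a::field_char_0 ell_point)"
proof (induction m arbitrary: n rule: int_induct[where k = 0])
  case (step1 m)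
  show ?case
    unfolding shift_orbit_E[of m, symmetric] add_shift_left[OF on_E_orbit on_E_orbit]
    unfolding shift_orbit_E step1(2) by (simp add: algebra_simps)
next
  case (step2 m)
  have "add_E (orbit_E (m - 1)) (orbit_E n) = add_E (orbit_E (m - 1)) (shift (orbit_E (n - 1) :: 'a ell_point))"
    by (simp add: shift_orbit_E)
  also have "\<dots> = add_E (shift (orbit_E (m - 1))) (orbit_E (n - 1))"
    by (rule add_shift_left[symmetric]) simp_all
  also have "\<dots> = orbit_E (m - 1 + n)"
    unfolding shift_orbit_E using step2(2)[of "n - 1"] by (simp add: algebra_simps)
  finally show ?case .
qed simp

lemma shift_eq_orbit_E:
  assumes "on_E p" "shift p = orbit_E n"
  shows "p = orbit_E (n - 1)"
proof -
  have "p = ell_neg (shift (ell_neg (shift p)))" using assms(1) by (rule neg_shift_neg_shift[symmetric])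
  also have "\<dots> = orbit_E (n - 1)"
    unfolding assms(2) orbit_E_uminus[symmetric] shift_orbit_E by simp
  finally show ?thesis .
qed

text \<open>The cubic \<open>z\<^sup>3 + 3 z\<^sup>2 - 4 z + 1\<close> is irreducible modulo 2.\<close>

lemma cubic_form_odd:
  fixes p q :: int
  assumes "odd p \<or> odd q"
  shows "odd (p^3 + 3*p^2*q - 4*p*q^2 + q^3)"
  using assms by auto

lemma rat_coprime_quotient:
  fixes r :: rat
  obtains p q :: int where "q > 0" "coprime p q" "r = of_int p / of_int q"
  using Rat_cases[of r] by (metis Fract_of_int_quotient)

lemma cubic_no_rat_root: "(z::rat)^3 + 3*z^2 - 4*z + 1 \<noteq> 0"
proof
  assume *: "z^3 + 3*z^2 - 4*z + 1 = 0"
  obtain p q :: int where q: "q > 0" "coprime p q" and z: "z = of_int p / of_int q"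
    by (rule rat_coprime_quotient)
  define Q where "Q = rat_of_int q"
  have Q: "Q \<noteq> 0" using q(1) by (simp add: Q_def)
  have "rat_of_int (p^3 + 3*p^2*q - 4*p*q^2 + q^3) = Q^3 * (z^3 + 3*z^2 - 4*z + 1)"
    using Q unfolding z Q_def[symmetric]
      by (simp add: Q_def[symmetric] field_simps power2_eq_square power3_eq_cube)
  then have "p^3 + 3*p^2*q - 4*p*q^2 + q^3 = 0" unfolding * by (simp only: mult_zero_right of_int_eq_0_iff)
  moreover have "odd p \<or> odd q" using q(2) by (metis coprime_common_divisor odd_one)
  ultimately show False using cubic_form_odd[of p q] by simp
qed

section \<open>The base point has infinite order\<close>

lemma on_E_rat_y_nonzero: "on_E (Affine x (y::rat)) \<Longrightarrow> y \<noteq> 0"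
  using on_E_iff[of "x + 1" y] cubic_no_rat_root[of "x + 1"] by auto

lemma double_E:
  fixes z y :: "'a::field_char_0"
  assumes "on_E (Affine (z - 1) y)" "y \<noteq> 0"
  obtains y' where "add_E (Affine (z - 1) y) (Affine (z - 1) y) =
    Affine ((z^4 + 8*z^2 - 8*z + 4) / (4 * y^2) - 1) y'"
proof -
  have y: "y^2 = z^3 + 3*z^2 - 4*z + 1" using assms(1) by (simp only: on_E_iff)
  define l where "l = (3 * (z - 1)^2 + 2 * 6 * (z - 1) + 5) / (2 * y)"
  have "y \<noteq> - y" using assms(2) by (simp add: eq_neg_iff_add_eq_0)
  have "add_E (Affine (z - 1) y) (Affine (z - 1) y) = third_point 6 l (z - 1) y (z - 1)"
    using \<open>y \<noteq> - y\<close> by (simp only: ell_add.simps l_def if_False simp_thms)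
  also have "\<dots> = Affine (l^2 - 6 - (z - 1) - (z - 1)) (l * (z - 1 - (l^2 - 6 - (z - 1) - (z - 1))) - y)"
    by (simp only: third_point_def Let_def)
  also have "l^2 - 6 - (z - 1) - (z - 1) = (z^4 + 8*z^2 - 8*z + 4) / (4 * y^2) - 1"
  proof -
    have "3 * (z - 1)^2 + 2 * 6 * (z - 1) + 5 = 3*z^2 + 6*z - 4"
      by (simp add: power2_eq_square algebra_simps)
    then have "l = (3*z^2 + 6*z - 4) / (2 * y)" unfolding l_def by (simp only:)
    then have l2: "l^2 * (4 * y^2) = (3*z^2 + 6*z - 4)^2"
      using assms(2) by (simp add: power_divide power_mult_distrib)
    have "(l^2 - 6 - (z - 1) - (z - 1) + 1) * (4 * y^2) = (3*z^2 + 6*z - 4)^2 - (2*z + 3) * (4 * y^2)"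
      unfolding l2[symmetric] by (simp add: algebra_simps)
    also have "\<dots> = z^4 + 8*z^2 - 8*z + 4"
      unfolding y by (simp add: power2_eq_square power3_eq_cube power4_eq_xxxx algebra_simps)
    finally have "l^2 - 6 - (z - 1) - (z - 1) + 1 = (z^4 + 8*z^2 - 8*z + 4) / (4 * y^2)"
      using assms(2) by (simp add: nonzero_eq_divide_eq)
    then show ?thesis by (simp only: eq_diff_eq)
  qed
  finally show thesis by (rule that)
qed

lemma double_E_numerator_pos: "(z::rat)^4 + 8*z^2 - 8*z + 4 > 0"
proof -
  have "z^4 + 8*z^2 - 8*z + 4 = (z^2)^2 + 8 * (z - 1/2)^2 + 2"
    by (simp add: power2_eq_square power4_eq_xxxx algebra_simps)
  then show ?thesis using zero_le_power2[of "z^2"] zero_le_power2[of "z - 1/2"] by linarith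
qed

text \<open>The base point has \<open>z = 0\<close>, whereas the duplication formula gives every
  affine rational point a double with positive \<open>z\<close>.\<close>

lemma add_E_self_ne_base_point: 
  assumes "on_E (p :: rat ell_point)"
  shows "add_E p p \<noteq> base_point"
proof (cases p)
  case (Affine x y)
  define z where "z = x + 1"
  have p: "p = Affine (z - 1) y" by (simp add: Affine z_def)
  have y: "y \<noteq> 0" using assms on_E_rat_y_nonzero unfolding p by blast
  obtain y' where y': "add_E p p = Affine ((z^4 + 8*z^2 - 8*z + 4) / (4 * y^2) - 1) y'"
    using double_E[OF assms[unfolded p] y] unfolding p by blast
  have "(z^4 + 8*z^2 - 8*z + 4) / (4 * y^2) \<noteq> 0" using double_E_numerator_pos[of z] y by simp
  then show ?thesis unfolding y' by simp
qed simp

text \<open>If an even multiple \<open>2 k\<close> vanished, then the multiple \<open>k\<close>,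
  affine by induction, would be 2-torsion and have \<open>y = 0\<close>. If an odd multiple
  \<open>2 k + 1\<close> vanished, the base point would be the double of its multiple by
  \<open>-k\<close>.\<close>

lemma orbit_E_nat_ne_Infinity: "n > 0 \<Longrightarrow> (orbit_E (int n) :: rat ell_point) \<noteq> Infinity"
proof (induction n rule: less_induct)
  case (less n)
  show ?case
  proof
    assume *: "(orbit_E (int n) :: rat ell_point) = Infinity"
    show False
    proof (cases "even n")
      case True
      then obtain k where k: "n = k + k" by (metis evenE mult_2)
      then have "(orbit_E (int k) :: rat ell_point) \<noteq> Infinity" using less by simp
      then obtain x y where xy: "(orbit_E (int k) :: rat ell_point) = Affine x y"
          by (cases "orbit_E (int k) :: rat ell_point") auto
      have "on_E (Affine x y)" unfolding xy[symmetric] by simp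
      then have "y \<noteq> 0" by (rule on_E_rat_y_nonzero)
      then have "add_E (Affine x y) (Affine x y) \<noteq> Infinity" 
        by (simp add: third_point_def Let_def eq_neg_iff_add_eq_0)
      then show False using orbit_E_add[of "int k" "int k", where 'a = rat] * unfolding xy[symmetric] k by simp
    next
      case False
      then obtain k where k: "n = 2 * k + 1" by (rule oddE)
      define j where "j = - int k"
      have "(base_point :: rat ell_point) = add_E (orbit_E (int n)) (orbit_E (j + j))"
        unfolding orbit_E_add orbit_E_1[symmetric] k j_def by simp
      also have "\<dots> = add_E (orbit_E j) (orbit_E j)" unfolding * orbit_E_add by simp
      finally show False using add_E_self_ne_base_point[OF on_E_orbit[of j]] by metis
    qed
  qed
qed

lemma orbit_E_eq_Infinity_iff: "(orbit_E n :: rat ell_point) = Infinity \<longleftrightarrow> n = 0"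
proof
  assume *: "(orbit_E n :: rat ell_point) = Infinity"
  show "n = 0"
  proof (rule ccontr)
    assume "n \<noteq> 0"
    then consider "n > 0" | "- n > 0" by linarith
    then show False
    proof cases
      case 1
      then show False using orbit_E_nat_ne_Infinity[of "nat n"] * by simp
    next
      case 2
      then have "(orbit_E (- n) :: rat ell_point) \<noteq> Infinity"
          using orbit_E_nat_ne_Infinity[of "nat (- n)"] by simp
      then show False using * by (simp add: orbit_E_uminus)
    qed
  qed
qed simp

lemma inj_orbit_E: "inj (orbit_E :: int \<Rightarrow> rat ell_point)"
proof (rule injI)
  fix m n
  assume "(orbit_E m :: rat ell_point) = orbit_E n"
  then have "(orbit_E (m - n) :: rat ell_point) = orbit_E (n - n)"
    unfolding diff_conv_add_uminus orbit_E_add[symmetric] by simp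
  then show "m = n" by (simp add: orbit_E_eq_Infinity_iff)
qed

section \<open>Torsion and rank of a group isomorphic to the integers\<close>

lemma group_if_integer_group_iso:
  assumes "h \<in> iso integer_group G" "monoid G"
  shows "group G"
  using group.iso_imp_group[OF group_integer_group _ assms(2)] assms(1) by (auto simp: is_iso_def)

lemma torsion_integer_group_iso:
  assumes h: "h \<in> iso integer_group G" and G: "group G"
  shows "torsion G = {\<one>\<^bsub>G\<^esub>}"
proof -
  have hom: "h \<in> hom integer_group G" and bij: "bij_betw h UNIV (carrier G)"
    using h by (auto simp: iso_def)
  have h0: "h 0 = \<one>\<^bsub>G\<^esub>" using hom_one[OF hom group_integer_group G] by simp
  have "x = \<one>\<^bsub>G\<^esub>" if x: "x \<in> torsion G" for x
  proof -
    obtain n :: nat where n: "n > 0" "x [^]\<^bsub>G\<^esub> n = \<one>\<^bsub>G\<^esub>"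
        and "x \<in> carrier G" using x by (auto simp: torsion_def)
    then obtain m where m: "x = h m" using bij by (auto simp: bij_betw_def)
    have "h (int n * m) = h 0"
      using hom_nat_pow[OF hom _ group_integer_group G, of m n] n(2) h0 unfolding m by simp
    moreover have "inj h" using bij by (simp add: bij_betw_def)
    ultimately have "int n * m = 0" by (simp only: inj_eq)
    then show ?thesis using n(1) h0 m by simp
  qed
  moreover have "\<one>\<^bsub>G\<^esub> \<in> torsion G"
    using G unfolding torsion_def by (auto intro!: exI[of _ "1::nat"] simp: group.is_monoid monoid.nat_pow_one)
  ultimately show ?thesis by blast
qed

lemma has_rank_1_if_integer_group_iso:
  assumes h: "h \<in> iso integer_group G" and G: "group G"
  shows "has_rank G 1"
proof -
  have "integer_group \<cong> G" using h by (auto simp: is_iso_def)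
  then have "G \<cong> integer_group" using group.iso_sym[OF group_integer_group] by blast
  moreover have "integer_group \<cong> free_Abelian_group {..<1::nat}"
    using isomorphic_group_integer_free_Abelian_group_singleton[of "0::nat"] by (simp add: lessThan_Suc)
  ultimately have "G \<cong> free_Abelian_group {..<1::nat}" by (rule iso_trans)
  then obtain k where "k \<in> iso G (free_Abelian_group {..<1::nat})" by (auto simp: is_iso_def)
  then have k: "k \<in> hom G (free_Abelian_group {..<1::nat})" 
    and bij: "bij_betw k (carrier G) (carrier (free_Abelian_group {..<1::nat}))"
    by (auto simp: iso_def)
  have tors: "torsion G = {\<one>\<^bsub>G\<^esub>}" using h G by (rule torsion_integer_group_iso)
  interpret group G by (rule G)
  have "(\<lambda>x. (\<one>\<^bsub>G\<^esub>, k x)) \<in> iso G (G\<lparr>carrier := torsion G\<rparr> \<times>\<times> free_Abelian_group {..<1::nat})"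
  proof (rule isoI)
    show "(\<lambda>x. (\<one>\<^bsub>G\<^esub>, k x)) \<in> hom G (G\<lparr>carrier := torsion G\<rparr> \<times>\<times> free_Abelian_group {..<1::nat})"
      using k by (auto simp: hom_def tors DirProd_def Pi_iff)
    show "bij_betw (\<lambda>x. (\<one>\<^bsub>G\<^esub>, k x)) (carrier G)
      (carrier (G\<lparr>carrier := torsion G\<rparr> \<times>\<times> free_Abelian_group {..<1::nat}))"
      using bij by (auto simp: bij_betw_def inj_on_def tors DirProd_def)
  qed
  then show ?thesis unfolding has_rank_def is_iso_def by blast
qed

lemma carrier_E7: "carrier E7 = {p. on_E p}"
  and mult_E7: "x \<otimes>\<^bsub>E7\<^esub> y = add_E x y"
  and one_E7: "\<one>\<^bsub>E7\<^esub> = Infinity"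
  by (simp_all add: E7_def ell_group_def)

section \<open>U_7 and rational points of the curve\<close>

lemma rat_square_of_int:
  fixes r :: rat and n :: int
  assumes "r^2 = of_int n"
  obtains k :: int where "n = k^2"
proof -
  obtain p q :: int where q: "q > 0" "coprime p q" and r: "r = of_int p / of_int q"
    by (rule rat_coprime_quotient)
  have "rat_of_int (p^2) = rat_of_int (q^2 * n)"
    using assms q(1) unfolding r by (simp add: power_divide field_simps)
  then have "q^2 * n = p^2" by (simp only: of_int_eq_iff)
  moreover have "q \<noteq> 0" using q(1) by simp
  ultimately show thesis using is_square_mult_cancel that by metis
qed

text \<open>\<open>U_7\<close> is homogeneous of degree 3 in \<open>P^2\<close> and
  \<open>Q\<close>, so it equals \<open>P^6\<close> times the cubic at \<open>-Q / P^2\<close>, and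
  \<open>P^6\<close> is a square. A rational root of an integer is integral, which gives the
  converse.\<close>

lemma lucas_U_7_square_iff_on_E:
  assumes "P \<noteq> 0"
  shows "is_square (lucas_U P Q 7) \<longleftrightarrow>
    (\<exists>y::rat. on_E (Affine (- rat_of_int Q / (rat_of_int P)^2) y))"
proof -
  define p where "p = rat_of_int P"
  define q where "q = rat_of_int Q"
  define x where "x = - q / p^2"
  have p: "p \<noteq> 0" using assms by (simp add: p_def)
  have xp: "x * p^2 = - q" using p by (simp add: x_def)
  have "p^6 * (x^3 + 6 * x^2 + 5 * x + 1) = (x * p^2)^3 + 6 * (x * p^2)^2 * p^2 + 5 * (x * p^2) * p^4 + p^6"
    by (simp add: power_mult_distrib algebra_simps flip: power_mult power_add)
  also have "\<dots> = rat_of_int (lucas_U P Q 7)"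
    unfolding lucas_U_7 xp by (simp add: p_def q_def algebra_simps)
  finally have U: "p^6 * (x^3 + 6 * x^2 + 5 * x + 1) = rat_of_int (lucas_U P Q 7)" .
  have p6: "p^6 = (p^3)^2" by (simp flip: power_mult)
  show ?thesis unfolding p_def[symmetric] q_def[symmetric] x_def[symmetric] on_curve.simps
  proof
    assume "is_square (lucas_U P Q 7)"
    then obtain c where c: "lucas_U P Q 7 = c^2" by (auto simp: is_square_iff)
    have "(p^3)^2 * ((of_int c / p^3)^2) = (p^3)^2 * (x^3 + 6 * x^2 + 5 * x + 1)"
      using U p unfolding p6 c by (simp add: power_divide)
    then have "(of_int c / p^3)^2 = x^3 + 6 * x^2 + 5 * x + 1" using p by simp
    then show "\<exists>y. y^2 = x^3 + 6 * x^2 + 5 * x + 1" by blast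
  next
    assume "\<exists>y. y^2 = x^3 + 6 * x^2 + 5 * x + 1"
    then obtain y where y: "y^2 = x^3 + 6 * x^2 + 5 * x + 1" by blast
    have "(p^3 * y)^2 = rat_of_int (lucas_U P Q 7)" using U unfolding p6 power_mult_distrib y .
    then obtain k where "lucas_U P Q 7 = k^2" by (rule rat_square_of_int)
    then show "is_square (lucas_U P Q 7)" by (auto simp: is_square_iff)
  qed
qed

subsection \<open>Hermite reduction of ternary forms\<close>

lemma nearest_multiple:
  fixes a d :: int
  assumes "a > 0"
  obtains k where "4 * (d + k * a)^2 \<le> a^2"
proof -
  define r where "r = d mod a"
  define j where "j = (if 2 * r \<le> a then - (d div a) else - (d div a) - 1)"
  have r: "0 \<le> r" "r < a" using assms by (simp_all add: r_def)
  have "d = a * (d div a) + r" by (simp add: r_def)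
  then have "d + j * a = (if 2 * r \<le> a then r else r - a)" by (simp add: j_def algebra_simps)
  then have "\<bar>2 * (d + j * a)\<bar> \<le> \<bar>a\<bar>" using r by (simp split: if_splits)
  then have "(2 * (d + j * a))^2 \<le> a^2" by (rule abs_le_square_iff[THEN iffD1])
  then have "4 * (d + j * a)^2 \<le> a^2" by (simp only: power_mult_distrib) simp
  then show thesis by (rule that)
qed

text \<open>The symmetric matrix of the form has rows (a, d, e), (d, b, f), (e, f, c);
  \<open>ternary_det\<close> is its determinant.\<close>

definition ternary_form :: "int \<Rightarrow> int \<Rightarrow> int \<Rightarrow> int \<Rightarrow> int \<Rightarrow> int \<Rightarrow> int \<Rightarrow> int \<Rightarrow> int \<Rightarrow> int" where
  "ternary_form a b c d e f x y z = a * x^2 + b * y^2 + c * z^2 + 2 * d * (x * y) + 2 * e * (x * z) + 2 * f * (y * z)"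

definition ternary_det :: "int \<Rightarrow> int \<Rightarrow> int \<Rightarrow> int \<Rightarrow> int \<Rightarrow> int \<Rightarrow> int" where
  "ternary_det a b c d e f = a * b * c + 2 * d * e * f - a * f^2 - b * e^2 - c * d^2"

text \<open>With \<open>v = a b - d\<^sup>2\<close> and the determinant \<open>D\<close>: steps that add a multiple of a basis vector to the next one
  and swap the two decrease \<open>(a, v)\<close> lexicographically, until \<open>3 a\<^sup>2 \<le> 4 v\<close> and \<open>3 v\<^sup>2 \<le> 4 a D\<close>.\<close>

theorem Hermite_ternary:
  assumes "a > 0" "a * b - d^2 > 0" "ternary_det a b c d e f > 0"
  shows "\<exists>x y z. (x, y, z) \<noteq> (0, 0, 0) \<and> 27 * ternary_form a b c d e f x y z ^ 3 \<le> 64 * ternary_det a b c d e f"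
  using assms
proof (induction "(nat a, nat (a * b - d^2))" arbitrary: a b c d e f rule: wf_induct_rule[OF wf_lex_prod[OF wf_less_than wf_less_than]])
  case (1 a b d c e f)
  define v where "v = a * b - d^2"
  define D where "D = ternary_det a b c d e f"
  have pos: "a > 0" "v > 0" "D > 0" using 1 by (simp_all add: v_def D_def)
  note IH = 1(1)[rule_format]
  consider (z) "3 * v^2 > 4 * (a * D)" | (y) "3 * a^2 > 4 * v" | (x) "3 * v^2 \<le> 4 * (a * D)" "3 * a^2 \<le> 4 * v"
    by linarith
  then show ?case
  proof cases
    case z
    \<comment> \<open>The numbers \<open>v\<close>, \<open>q\<close> and \<open>a*c - e^2\<close>
      are, up to the scale \<open>a\<close>, the entries of the binary form orthogonal to the first
      basis vector. Its scaled determinant is \<open>v * (a*c - e^2) - q^2 = a * D\<close>; reducing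
      \<open>q\<close> modulo \<open>v\<close> therefore lowers the minor.\<close>
    define q where "q = a * f - d * e"
    obtain k where k: "4 * (q + k * v)^2 \<le> v^2" using nearest_multiple[OF pos(2)] by blast
    define c' e' f' where "c' = c + 2 * k * f + k^2 * b" and "e' = e + k * d" and "f' = f + k * b"
    have f': "ternary_form a c' b e' d f' x y z = ternary_form a b c d e f x (z + k * y) y" for x y z
      by (simp add: ternary_form_def c'_def e'_def f'_def algebra_simps power2_eq_square)
    have D': "ternary_det a c' b e' d f' = D"
      by (simp add: D_def ternary_det_def c'_def e'_def f'_def algebra_simps power2_eq_square)
    have v': "(a * c' - e'^2) * v = a * D + (q + k * v)^2"
      by (simp add: D_def ternary_det_def c'_def e'_def f'_def q_def v_def algebra_simps power2_eq_square)
    have "(a * c' - e'^2) * v > 0" unfolding v' using pos by (simp add: add_pos_nonneg)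
    then have p': "a * c' - e'^2 > 0" using pos(2) by (simp add: zero_less_mult_iff)
    have "(a * c' - e'^2) * v < v * v" unfolding v' using z k by (simp add: power2_eq_square)
    then have "a * c' - e'^2 < v" using pos(2) by simp
    then have "((nat a, nat (a * c' - e'^2)), (nat a, nat (a * b - d^2))) \<in> less_than <*lex*> less_than"
      using p' by (simp add: v_def)
    from IH[OF this pos(1) p' pos(3)[folded D']] obtain x y z 
      where xyz: "(x, y, z) \<noteq> (0, 0, 0)" "27 * ternary_form a c' b e' d f' x y z ^ 3 \<le> 64 * D"
          unfolding D' by blast
    have "(x, z + k * y, y) \<noteq> (0, 0, 0)" using xyz(1) by auto
    then show ?thesis using xyz(2) unfolding f' D_def[symmetric] by blast
  next
    case y
    \<comment> \<open>Reducing \<open>d\<close> modulo \<open>a\<close> keeps the minor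
      \<open>v\<close>. The new leading coefficient \<open>b'\<close> satisfies
      \<open>b' * a = v + d'^2\<close>, which is below \<open>3/4 a^2 + 1/4 a^2\<close>.\<close>
    obtain k where k: "4 * (d + k * a)^2 \<le> a^2" using nearest_multiple[OF pos(1)] by blast
    define b' d' f' where "b' = b + 2 * k * d + k^2 * a" and "d' = d + k * a" and "f' = f + k * e"
    have f': "ternary_form b' a c d' f' e x y z = ternary_form a b c d e f (y + k * x) x z" for x y z
      by (simp add: ternary_form_def b'_def d'_def f'_def algebra_simps power2_eq_square)
    have D': "ternary_det b' a c d' f' e = D"
      by (simp add: D_def ternary_det_def b'_def d'_def f'_def algebra_simps power2_eq_square)
    have v': "b' * a - d'^2 = v"
      by (simp add: v_def b'_def d'_def algebra_simps power2_eq_square)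
    then have ab: "b' * a = v + d'^2" by simp
    have "b' * a > 0" unfolding ab using pos by (simp add: add_pos_nonneg)
    then have p': "b' > 0" using pos(1) by (simp add: zero_less_mult_iff)
    have "b' * a < a * a" unfolding ab using y k unfolding d'_def[symmetric] by (simp add: power2_eq_square)
    then have "b' < a" using pos(1) by simp
    then have "((nat b', nat (b' * a - d'^2)), (nat a, nat (a * b - d^2))) \<in> less_than <*lex*> less_than"
      using p' by simp
    from IH[OF this p' pos(2)[folded v'] pos(3)[folded D']] obtain x y z 
      where xyz: "(x, y, z) \<noteq> (0, 0, 0)" "27 * ternary_form b' a c d' f' e x y z ^ 3 \<le> 64 * D"
          unfolding D' by blast
    have "(y + k * x, x, z) \<noteq> (0, 0, 0)" using xyz(1) by auto
    then show ?thesis using xyz(2) unfolding f' D_def[symmetric] by blast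
  next
    case x
    \<comment> \<open>Eliminating \<open>v\<close> from the two reduction inequalities bounds
      \<open>a^3\<close>, so the first basis vector is the witness.\<close>
    have "(3 * a^2)^2 \<le> (4 * v)^2" using x(2) by (intro power_mono) simp_all
    then have "27 * a^4 \<le> 16 * (3 * v^2)" by (simp add: power_mult_distrib flip: power_mult)
    also have "\<dots> \<le> 64 * (a * D)" using x(1) by linarith
    finally have "a * (27 * a^3) \<le> a * (64 * D)" by (simp add: power_numeral_reduce)
    then have "27 * a^3 \<le> 64 * D" using pos(1) by simp
    moreover have "ternary_form a b c d e f 1 0 0 = a" by (simp add: ternary_form_def)
    ultimately have "27 * ternary_form a b c d e f 1 0 0 ^ 3 \<le> 64 * D" by simp
    then show ?thesis unfolding D_def[symmetric] by (intro exI[of _ 1] exI[of _ 0]) simp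
  qed
qed

subsection \<open>Squares in the cubic ring\<close>

text \<open>The norm of \<open>a + b \<theta> + c \<theta>\<^sup>2\<close> for a root \<open>\<theta>\<close> of \<open>z\<^sup>3 + 3 z\<^sup>2 - 4 z + 1\<close>. The cubic is irreducible modulo 2.\<close>

definition cubic_norm :: "int \<Rightarrow> int \<Rightarrow> int \<Rightarrow> int" where
  "cubic_norm a b c = a^3 - 3*a^2*b + 17*a^2* c - 4*a*b^2 + 15*a*b* c + 10*a* c^2 - b^3 + 3*b^2* c + 4*b* c^2 + c^3"

lemma cubic_norm_even:
  assumes "even (cubic_norm a b c)"
  shows "even a \<and> even b \<and> even c"
  using assms by (cases "even a"; cases "even b"; cases "even c") (simp_all add: cubic_norm_def)

text \<open>Infinite descent: a zero of the norm has even coordinates, and halving them gives a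
  smaller zero.\<close>

lemma cubic_norm_zeroD:
  assumes "cubic_norm a b c = 0"
  shows "a = 0 \<and> b = 0 \<and> c = 0"
  using assms
proof (induction "nat (\<bar>a\<bar> + \<bar>b\<bar> + \<bar>c\<bar>)" arbitrary: a b c rule: less_induct)
  case less
  obtain a' b' c' where *: "a = 2 * a'" "b = 2 * b'" "c = 2 * c'"
    using cubic_norm_even[of a b c] less(2) by (auto elim!: evenE)
  have "8 * cubic_norm a' b' c' = 0" 
    using less(2) unfolding * by (simp add: cubic_norm_def power_mult_distrib)
  then have N: "cubic_norm a' b' c' = 0" by simp
  show ?case
  proof (rule ccontr)
    assume "\<not> ?thesis"
    then have "nat (\<bar>a'\<bar> + \<bar>b'\<bar> + \<bar>c'\<bar>) < nat (\<bar>a\<bar> + \<bar>b\<bar> + \<bar>c\<bar>)" unfolding * by auto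
    from less(1)[OF this N] \<open>\<not> ?thesis\<close> show False unfolding * by simp
  qed
qed

text \<open>The number field is not constructed. An element is a triple of integers, seen through
  its three real conjugates, and the Vieta relations reduce all computations to symmetric
  functions.\<close>

locale cubic_roots =
  fixes t1 t2 t3 :: real
  assumes sum_roots: "t1 + t2 + t3 = - 3"
    and sum_mult_roots: "t1 * t2 + t1 * t3 + t2 * t3 = - 4"
    and prod_roots: "t1 * t2 * t3 = - 1"
begin

definition roots :: "real set" where "roots = {t1, t2, t3}"

definition ev :: "int \<Rightarrow> int \<Rightarrow> int \<Rightarrow> real \<Rightarrow> real" where
  "ev a b c t = of_int a + of_int b * t + of_int c * t^2"

lemma root_cube: 
  assumes "t \<in> roots"
  shows "t^3 = - 3 * t^2 + 4 * t - 1"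
proof -
  have "t^3 - (t1 + t2 + t3) * t^2 + (t1 * t2 + t1 * t3 + t2 * t3) * t - t1 * t2 * t3 
    = (t - t1) * (t - t2) * (t - t3)"
    by (simp add: power2_eq_square power3_eq_cube algebra_simps)
  also have "\<dots> = 0" using assms by (auto simp: roots_def)
  finally show ?thesis unfolding sum_roots sum_mult_roots prod_roots by linarith
qed

lemma root_fourth: 
  assumes "t \<in> roots"
  shows "t^4 = 13 * t^2 - 13 * t + 3"
proof -
  have "t^4 = t * t^3" by (simp add: power_numeral_reduce)
  also have "\<dots> = t * (- 3 * t^2 + 4 * t - 1)" by (simp only: root_cube[OF assms])
  also have "\<dots> = - 3 * t^3 + 4 * t^2 - t" by (simp add: power2_eq_square power3_eq_cube algebra_simps)
  finally show ?thesis unfolding root_cube[OF assms] by simp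
qed

lemma sum_square_roots: "t1^2 + t2^2 + t3^2 = 17"
proof -
  have "t1^2 + t2^2 + t3^2 = (t1 + t2 + t3)^2 - 2 * (t1 * t2 + t1 * t3 + t2 * t3)"
    by (simp add: power2_eq_square algebra_simps)
  then show ?thesis unfolding sum_roots sum_mult_roots by simp
qed

lemma discriminant_roots: "((t2 - t1) * (t3 - t1) * (t3 - t2))^2 = 49"
proof -
  define s p q where "s = t1 + t2 + t3" and "p = t1 * t2 + t1 * t3 + t2 * t3" and "q = t1 * t2 * t3"
  have spq: "s = - 3" "p = - 4" "q = - 1"
    by (simp_all only: s_def p_def q_def sum_roots sum_mult_roots prod_roots)
  have "((t2 - t1) * (t3 - t1) * (t3 - t2))^2 = s^2 * p^2 - 4 * p^3 - 4 * s^3 * q + 18 * s * p * q - 27 * q^2"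
    unfolding s_def p_def q_def by algebra
  then show ?thesis by (simp add: spq)
qed

lemma ev_trace: "ev a b c t1 + ev a b c t2 + ev a b c t3 = of_int (3 * a - 3 * b + 17 * c)"
proof -
  have "ev a b c t1 + ev a b c t2 + ev a b c t3 = 3 * of_int a + of_int b * (t1 + t2 + t3) + of_int c * (t1^2 + t2^2 + t3^2)"
    by (simp add: ev_def algebra_simps)
  then show ?thesis unfolding sum_roots sum_square_roots by simp
qed

lemma ev_second: "ev a b c t1 * ev a b c t2 + ev a b c t1 * ev a b c t3 + ev a b c t2 * ev a b c t3 =
   of_int (3*a^2 - 6*a*b + 34*a* c - 4*b^2 + 15*b* c + 10* c^2)"
proof -
  define s p q where "s = t1 + t2 + t3" and "p = t1 * t2 + t1 * t3 + t2 * t3" and "q = t1 * t2 * t3"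
  have spq: "s = - 3" "p = - 4" "q = - 1"
    by (simp_all only: s_def p_def q_def sum_roots sum_mult_roots prod_roots)
  define x y z where "x = real_of_int a" and "y = real_of_int b" and "z = real_of_int c"
  have "ev a b c t1 * ev a b c t2 + ev a b c t1 * ev a b c t3 + ev a b c t2 * ev a b c t3 =
    3*x^2 + 2*x*y*s + 2*x*z*(s^2 - 2*p) + y^2*p + y*z*(s*p - 3*q) + z^2*(p^2 - 2*s*q)"
    unfolding ev_def s_def p_def q_def x_def[symmetric] y_def[symmetric] z_def[symmetric] by algebra
  then show ?thesis 
    by (simp add: spq x_def y_def z_def algebra_simps)
qed

lemma ev_norm: "ev a b c t1 * ev a b c t2 * ev a b c t3 = of_int (cubic_norm a b c)"
proof -
  define s p q where "s = t1 + t2 + t3" and "p = t1 * t2 + t1 * t3 + t2 * t3" and "q = t1 * t2 * t3"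
  have spq: "s = - 3" "p = - 4" "q = - 1"
    by (simp_all only: s_def p_def q_def sum_roots sum_mult_roots prod_roots)
  define x y z where "x = real_of_int a" and "y = real_of_int b" and "z = real_of_int c"
  have "ev a b c t1 * ev a b c t2 * ev a b c t3 =
    x^3 + x^2*y*s + x^2*z*(s^2 - 2*p) + x*y^2*p + x*y*z*(s*p - 3*q) + x*z^2*(p^2 - 2*s*q)
     + y^3*q + y^2*z*q*s + y*z^2*q*p + z^3*q^2"
    unfolding ev_def s_def p_def q_def x_def[symmetric] y_def[symmetric] z_def[symmetric] by algebra
  then show ?thesis 
    by (simp add: spq x_def y_def z_def cubic_norm_def algebra_simps)
qed

lemma ev_eq_0D:
  assumes "t \<in> roots" "ev a b c t = 0"
  shows "a = 0 \<and> b = 0 \<and> c = 0"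
proof -
  have "real_of_int (cubic_norm a b c) = 0"
    unfolding ev_norm[symmetric] using assms by (auto simp: roots_def)
  then show ?thesis by (intro cubic_norm_zeroD) simp
qed

lemma ev_eqD:
  assumes "t \<in> roots" "ev a b c t = ev a' b' c' t"
  shows "a = a' \<and> b = b' \<and> c = c'"
  using ev_eq_0D[of t "a - a'" "b - b'" "c - c'"] assms by (simp add: ev_def algebra_simps)

lemma ev_mult:
  assumes "t \<in> roots"
  shows "ev a b c t * ev a' b' c' t = ev (a*a' - b* c' - c*b' + 3* c* c') (a*b' + b*a' + 4*b* c' + 4* c*b' - 13* c* c')
     (a* c' + b*b' + c*a' - 3*b* c' - 3* c*b' + 13* c* c') t"
proof -
  define x y z where "x = real_of_int a" and "y = real_of_int b" and "z = real_of_int c"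
  define x' y' z' where "x' = real_of_int a'" and "y' = real_of_int b'" and "z' = real_of_int c'"
  have "ev a b c t * ev a' b' c' t = x*x' + (x*y' + y*x')*t + (x*z' + y*y' + z*x')*t^2 + (y*z' + z*y')*t^3 + z*z'*t^4"
    unfolding ev_def x_def[symmetric] y_def[symmetric] z_def[symmetric] x'_def[symmetric] y'_def[symmetric] z'_def[symmetric]
    by algebra
  then show ?thesis unfolding root_cube[OF assms] root_fourth[OF assms]
    by (simp add: ev_def x_def y_def z_def x'_def y'_def z'_def algebra_simps)
qed

text \<open>The elementary symmetric functions of the conjugates satisfy the Maclaurin inequalities, and
  \<open>e\<^sub>1\<^sup>2 - 3 e\<^sub>2\<close> is 7 times the value of a positive definite integral form in \<open>b, c\<close>.\<close>

lemma eq_1_if_trace_le_4: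
  assumes pos: "\<And>t. t \<in> roots \<Longrightarrow> ev a b c t > 0"
      and tr: "ev a b c t1 + ev a b c t2 + ev a b c t3 \<le> 4"
  shows "a = 1 \<and> b = 0 \<and> c = 0"
proof -
  define e1 where "e1 = 3 * a - 3 * b + 17 * c"
  define e2 where "e2 = 3*a^2 - 6*a*b + 34*a* c - 4*b^2 + 15*b* c + 10* c^2"
  define e3 where "e3 = cubic_norm a b c"
  define x y z where "x = ev a b c t1" and "y = ev a b c t2" and "z = ev a b c t3"
  have p: "x > 0" "y > 0" "z > 0" using pos by (simp_all add: x_def y_def z_def roots_def)
  have e: "real_of_int e1 = x + y + z" "real_of_int e2 = x * y + x * z + y * z" "real_of_int e3 = x * y * z"
    unfolding x_def y_def z_def ev_trace ev_second ev_norm e1_def e2_def e3_def by simp_all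
  have "real_of_int e1 > 0" "real_of_int e2 > 0" "real_of_int e3 > 0" 
    unfolding e using p by (simp_all add: add_pos_pos)
  then have epos: "e1 > 0" "e2 > 0" "e3 > 0" by (simp_all only: of_int_0_less_iff)
  have "real_of_int e1 \<le> 4" unfolding e using tr by (simp add: x_def y_def z_def)
  then have "e1 \<le> 4" by linarith
  have "2 * ((x * y + x * z + y * z)^2 - 3 * (x + y + z) * (x * y * z)) = 
    (x*y - x*z)^2 + (x*y - y*z)^2 + (x*z - y*z)^2" by algebra
  then have "(x * y + x * z + y * z)^2 \<ge> 3 * (x + y + z) * (x * y * z)" 
    by (smt (verit) zero_le_power2)
  then have "real_of_int (e2^2) \<ge> real_of_int (3 * e1 * e3)"
      by (simp only: of_int_mult of_int_power e of_int_numeral)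
  then have m2: "e2^2 \<ge> 3 * e1 * e3" by (simp only: of_int_le_iff)
  have "3 * e1 * e3 \<ge> 3 * e1 * 1" using epos by (intro mult_left_mono) simp_all
  with m2 have m2: "e2^2 \<ge> 3 * e1" by simp
  have d: "e1^2 - 3 * e2 = 7 * (3*b^2 - 21*b* c + 37* c^2)"
    unfolding e1_def e2_def by algebra
  have d12: "12 * (3*b^2 - 21*b* c + 37* c^2) = (6*b - 21* c)^2 + 3* c^2" by algebra
  then have "e1^2 \<ge> 3 * e2" using d by (smt (verit) zero_le_power2)
  \<comment> \<open>Traces 1 and 2 contradict the inequalities. Trace 4 leaves \<open>e2 = 4\<close>
    or \<open>e2 = 5\<close>, where \<open>16 - 3 * e2\<close> is 4 or 1 and not a multiple of 7.
    Trace 3 forces \<open>e2 = 3\<close>, and then the definite form in \<open>b\<close> and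
    \<open>c\<close> vanishes.\<close>
  consider "e1 = 1" | "e1 = 2" | "e1 = 3" | "e1 = 4" using \<open>e1 \<le> 4\<close> epos(1) by linarith
  then have "e1 = 3 \<and> e2 = 3"
  proof cases
    case 1
    then show ?thesis using \<open>e1^2 \<ge> 3 * e2\<close> epos by simp
  next
    case 2
    then have "e2 = 1" using \<open>e1^2 \<ge> 3 * e2\<close> epos by simp
    then show ?thesis using m2 2 by simp
  next
    case 3
    then have "e2 \<in> {1, 2, 3}" using \<open>e1^2 \<ge> 3 * e2\<close> epos by auto
    then show ?thesis using m2 3 by auto
  next
    case 4
    then have "e2 \<in> {1, 2, 3, 4, 5}" using \<open>e1^2 \<ge> 3 * e2\<close> epos by auto
    moreover have "16 - 3 * e2 = 7 * (3*b^2 - 21*b* c + 37* c^2)" using d 4 by simp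
    then have "7 dvd 16 - 3 * e2" by simp
    ultimately show ?thesis using m2 4 by auto
  qed
  then have "(6*b - 21* c)^2 + 3* c^2 = 0" using d d12 by simp
  then have "(6*b - 21* c)^2 = 0 \<and> c^2 = 0" by (smt (verit) zero_le_power2)
  then have "c = 0" "b = 0" by simp_all
  then show ?thesis using \<open>e1 = 3 \<and> e2 = 3\<close> by (simp add: e1_def)
qed

end

section \<open>Totally positive elements of square norm\<close>

context cubic_roots
begin

text \<open>Membership in the ring generated by \<theta>, for a function of the conjugate. Closure
  under sums and products yields integral traces without computing any coefficients.\<close>

definition integral_on_roots :: "(real \<Rightarrow> real) \<Rightarrow> bool" where
  "integral_on_roots h \<longleftrightarrow> (\<exists>a b c. \<forall>t\<in>roots. h t = ev a b c t)"

lemma integral_on_roots_of_int [intro]: "integral_on_roots (\<lambda>_. of_int k)"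
  unfolding integral_on_roots_def by (rule exI[of _ k], rule exI[of _ 0], rule exI[of _ 0]) (simp add: ev_def)

lemma integral_on_roots_id [intro]: "integral_on_roots (\<lambda>t. t)"
  unfolding integral_on_roots_def by (rule exI[of _ 0], rule exI[of _ 1], rule exI[of _ 0]) (simp add: ev_def)

lemma integral_on_roots_add [intro]:
  assumes "integral_on_roots g" "integral_on_roots h"
  shows "integral_on_roots (\<lambda>t. g t + h t)"
proof -
  obtain a b c a' b' c'
      where "\<forall>t\<in>roots. g t = ev a b c t" "\<forall>t\<in>roots. h t = ev a' b' c' t"
    using assms unfolding integral_on_roots_def by blast
  then have "\<forall>t\<in>roots. g t + h t = ev (a + a') (b + b') (c + c') t"
      by (simp add: ev_def algebra_simps)
  then show ?thesis unfolding integral_on_roots_def by blast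
qed

lemma integral_on_roots_mult [intro]:
  assumes "integral_on_roots g" "integral_on_roots h"
  shows "integral_on_roots (\<lambda>t. g t * h t)"
proof -
  obtain a b c a' b' c'
      where "\<forall>t\<in>roots. g t = ev a b c t" "\<forall>t\<in>roots. h t = ev a' b' c' t"
    using assms unfolding integral_on_roots_def by blast
  then have "\<forall>t\<in>roots. g t * h t = ev (a*a' - b* c' - c*b' + 3* c* c') (a*b' + b*a' + 4*b* c' + 4* c*b' - 13* c* c')
     (a* c' + b*b' + c*a' - 3*b* c' - 3* c*b' + 13* c* c') t" using ev_mult by simp
  then show ?thesis unfolding integral_on_roots_def by blast
qed

lemma trace_integral_on_roots:
  assumes "integral_on_roots h"
  obtains n where "h t1 + h t2 + h t3 = of_int n"
proof -
  obtain a b c where "\<forall>t\<in>roots. h t = ev a b c t" using assms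
      unfolding integral_on_roots_def by blast
  then have "h t1 + h t2 + h t3 = of_int (3 * a - 3 * b + 17 * c)"
    using ev_trace by (simp add: roots_def)
  then show thesis by (rule that)
qed

lemma Lagrange_identity_3:
  fixes p1 :: real
  shows "(p1*x1^2 + p2*x2^2 + p3*x3^2) * (p1*y1^2 + p2*y2^2 + p3*y3^2) - (p1*(x1*y1) + p2*(x2*y2) + p3*(x3*y3))^2
    = p1*p2*(x1*y2 - x2*y1)^2 + p1*p3*(x1*y3 - x3*y1)^2 + p2*p3*(x2*y3 - x3*y2)^2"
  by algebra

text \<open>Multiplicativity of the determinant: a Gram matrix with diagonal weights has as
  determinant the product of the weights times the square of the determinant of the vectors.\<close>

lemma Gram_det_3:
  fixes p1 p2 p3 x1 x2 x3 y1 y2 y3 z1 z2 z3 :: real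
  defines "a \<equiv> p1*x1^2 + p2*x2^2 + p3*x3^2" and "b \<equiv> p1*y1^2 + p2*y2^2 + p3*y3^2"
      and "c \<equiv> p1*z1^2 + p2*z2^2 + p3*z3^2"
    and "d \<equiv> p1*(x1*y1) + p2*(x2*y2) + p3*(x3*y3)" and "e \<equiv> p1*(x1*z1) + p2*(x2*z2) + p3*(x3*z3)" 
    and "f \<equiv> p1*(y1*z1) + p2*(y2*z2) + p3*(y3*z3)"
  shows "a * b * c + 2 * d * e * f - a * f^2 - b * e^2 - c * d^2 =
    p1 * p2 * p3 * (x1 * (y2*z3 - y3*z2) - x2 * (y1*z3 - y3*z1) + x3 * (y1*z2 - y2*z1))^2"
  unfolding a_def b_def c_def d_def e_def f_def by algebra

text \<open>The elements \<open>x w + (\<theta> - r) (y + z \<theta>)\<close> form the ideal whose square should be generated by \<open>\<delta> = m - q \<theta>\<close>.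
  The quadratic form \<open>Tr (\<beta>\<^sup>2 / \<delta>)\<close> on it is integral with determinant 49, so that it has a value at most 4 by
  Hermite's bound; hence \<open>\<beta>\<^sup>2 / \<delta> = 1\<close>.\<close>

theorem totally_positive_square:
  fixes m q w :: int
  assumes norm: "w^2 = m^3 + 3*m^2*q - 4*m*q^2 + q^3" and "coprime q w" and w0: "w \<noteq> 0"
    and pos: "\<And>t. t \<in> roots \<Longrightarrow> of_int m - of_int q * t > 0" and "t1 \<noteq> t2" 
  obtains b0 b1 b2 where "m = b0^2 - 2*b1*b2 + 3*b2^2" "- q = 2*b0*b1 + 8*b1*b2 - 13*b2^2"
    "b1^2 + 2*b0*b2 - 6*b1*b2 + 13*b2^2 = 0"
proof -
  have "coprime q (w^2)" using assms(2) by simp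
  then obtain A B where AB: "A * q + B * w^2 = 1" using bezout_int[of q "w^2"]
      by (auto simp: coprime_iff_gcd_eq_1)
  \<comment> \<open>Modulo \<delta> one has \<open>q * \<theta> = m\<close> and
    \<open>w^2 = 0\<close>, so the relation for \<open>A\<close> and \<open>B\<close> makes \<theta>
    congruent to \<open>r = A * m\<close>. Below, \<kappa> is \<open>w^2 / \<delta>\<close> and
    \<mu> is \<open>(\<theta> - r) / \<delta>\<close>, written so that their integrality is
    visible.\<close>
  define r where "r = A * m"
  define \<delta> where "\<delta> t = of_int m - of_int q * t" for t :: real
  define \<kappa>
      where "\<kappa> t = of_int (m^2 + 3*m*q - 4*q^2) + of_int (m*q + 3*q^2) * t + of_int (q^2) * (t * t)" for t :: real
  define \<mu> where "\<mu> t = of_int (- A) + of_int B * (t * \<kappa> t)" for t :: real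
  define W R where "W = real_of_int w" and "R = real_of_int r"
  have \<delta>pos: "\<delta> t > 0" if "t \<in> roots" for t using pos[OF that] by (simp add: \<delta>_def)
  have \<kappa>: "\<kappa> t * \<delta> t = W^2" if "t \<in> roots" for t
  proof -
    have "\<kappa> t * \<delta> t = of_int m^3 + 3 * of_int m^2 * of_int q - 4 * of_int m * of_int q^2 - of_int q ^3 * (t^3 + 3*t^2 - 4*t)"
      unfolding \<kappa>_def \<delta>_def by (simp add: algebra_simps power2_eq_square power3_eq_cube)
    also have "\<dots> = of_int (w^2)" unfolding root_cube[OF that] norm by simp
    finally show ?thesis by (simp add: W_def)
  qed
  have \<mu>: "\<mu> t * \<delta> t = t - R" if "t \<in> roots" for t
  proof -
    have "\<mu> t * \<delta> t = - of_int A * \<delta> t + of_int B * t * (\<kappa> t * \<delta> t)"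
      unfolding \<mu>_def by (simp add: algebra_simps)
    also have "\<dots> = t * of_int (A * q + B * w^2) - of_int (A * m)"
      unfolding \<kappa>[OF that] by (simp add: \<delta>_def W_def algebra_simps)
    finally show ?thesis unfolding AB r_def R_def by simp
  qed
  have int_\<kappa>: "integral_on_roots \<kappa>" unfolding \<kappa>_def
      by (intro integral_on_roots_add integral_on_roots_mult integral_on_roots_of_int integral_on_roots_id)
  then have int_\<mu>: "integral_on_roots \<mu>" unfolding \<mu>_def
      by (intro integral_on_roots_add integral_on_roots_mult integral_on_roots_of_int integral_on_roots_id)
  have int_R: "integral_on_roots (\<lambda>t. t - R)" 
    using integral_on_roots_add[OF integral_on_roots_id integral_on_roots_of_int[of "- r"]] by (simp add: R_def)
  have int_W: "integral_on_roots (\<lambda>_. W)" unfolding W_def by (rule integral_on_roots_of_int)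
  note ints = integral_on_roots_mult int_\<kappa> int_\<mu> int_R int_W integral_on_roots_id
  define \<omega> :: "real \<Rightarrow> real" where "\<omega> t = (t - R) * t" for t
  \<comment> \<open>The six integers are the traces of the pairwise products of the ideal basis
    \<open>w\<close>, \<open>\<theta> - r\<close>, \<open>\<omega>\<close>, divided by \<delta>. In
    each product the division is carried out by \<kappa> or \<mu>.\<close>
  obtain a where a: "\<kappa> t1 + \<kappa> t2 + \<kappa> t3 = of_int a"
      using trace_integral_on_roots[OF int_\<kappa>] .
  have "integral_on_roots (\<lambda>t. (t - R) * \<mu> t)" by (intro ints)
  then obtain b where b: "(t1 - R) * \<mu> t1 + (t2 - R) * \<mu> t2 + (t3 - R) * \<mu> t3 = of_int b"
    by (rule trace_integral_on_roots)
  have "integral_on_roots (\<lambda>t. \<omega> t * (\<mu> t * t))" unfolding \<omega>_def by (intro ints)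
  then obtain c
      where c: "\<omega> t1 * (\<mu> t1 * t1) + \<omega> t2 * (\<mu> t2 * t2) + \<omega> t3 * (\<mu> t3 * t3) = of_int c"
    by (rule trace_integral_on_roots)
  have "integral_on_roots (\<lambda>t. W * \<mu> t)" by (intro ints)
  then obtain d where d: "W * \<mu> t1 + W * \<mu> t2 + W * \<mu> t3 = of_int d"
    by (rule trace_integral_on_roots)
  have "integral_on_roots (\<lambda>t. W * (\<mu> t * t))" by (intro ints)
  then obtain e where e: "W * (\<mu> t1 * t1) + W * (\<mu> t2 * t2) + W * (\<mu> t3 * t3) = of_int e"
    by (rule trace_integral_on_roots)
  have "integral_on_roots (\<lambda>t. \<omega> t * \<mu> t)" unfolding \<omega>_def by (intro ints)
  then obtain f where f: "\<omega> t1 * \<mu> t1 + \<omega> t2 * \<mu> t2 + \<omega> t3 * \<mu> t3 = of_int f"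
    by (rule trace_integral_on_roots)
  \<comment> \<open>With weights \<open>1 / \<delta>\<close> at the conjugates these integers become
    entries of a weighted Gram matrix, whose minors are then visibly positive.\<close>
  define p where "p t = 1 / \<delta> t" for t
  have roots: "t1 \<in> roots" "t2 \<in> roots" "t3 \<in> roots" by (simp_all add: roots_def)
  have p: "p t > 0" if "t \<in> roots" for t using \<delta>pos[OF that] by (simp add: p_def)
  have p\<kappa>: "\<kappa> t = p t * W^2" and p\<mu>: "\<mu> t = p t * (t - R)" if "t \<in> roots" for t
    using \<kappa>[OF that] \<mu>[OF that] \<delta>pos[OF that] by (simp_all add: p_def field_simps)
  note pp = p\<kappa>[OF roots(1)] p\<kappa>[OF roots(2)] p\<kappa>[OF roots(3)] p\<mu>[OF roots(1)] p\<mu>[OF roots(2)] p\<mu>[OF roots(3)]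
  have a': "real_of_int a = p t1 * W^2 + p t2 * W^2 + p t3 * W^2" unfolding a[symmetric] pp by simp
  have b': "real_of_int b = p t1 * (t1 - R)^2 + p t2 * (t2 - R)^2 + p t3 * (t3 - R)^2" 
    unfolding b[symmetric] pp by (simp add: power2_eq_square mult_ac)
  have c': "real_of_int c = p t1 * \<omega> t1^2 + p t2 * \<omega> t2^2 + p t3 * \<omega> t3^2"
    unfolding c[symmetric] pp by (simp add: power2_eq_square mult_ac \<omega>_def)
  have d': "real_of_int d = p t1 * (W * (t1 - R)) + p t2 * (W * (t2 - R)) + p t3 * (W * (t3 - R))"
    unfolding d[symmetric] pp by (simp add: mult_ac)
  have e': "real_of_int e = p t1 * (W * \<omega> t1) + p t2 * (W * \<omega> t2) + p t3 * (W * \<omega> t3)"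
    unfolding e[symmetric] pp by (simp add: mult_ac \<omega>_def)
  have f': "real_of_int f = p t1 * ((t1 - R) * \<omega> t1) + p t2 * ((t2 - R) * \<omega> t2) + p t3 * ((t3 - R) * \<omega> t3)"
    unfolding f[symmetric] pp by (simp add: mult_ac \<omega>_def)
  have W: "W \<noteq> 0" using w0 by (simp add: W_def)
  have "real_of_int a > 0" unfolding a' using W p[OF roots(1)] p[OF roots(2)] p[OF roots(3)]
      by (simp add: add_pos_pos)
  then have apos: "a > 0" by simp
  have vpos: "a * b - d^2 > 0"
  proof -
    have "real_of_int (a * b - d^2) = real_of_int a * real_of_int b - (real_of_int d)^2" by simp
    also have "\<dots> = p t1 * p t2 * (W * (t2 - R) - W * (t1 - R))^2 + 
      p t1 * p t3 * (W * (t3 - R) - W * (t1 - R))^2 + p t2 * p t3 * (W * (t3 - R) - W * (t2 - R))^2"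
      unfolding a' b' d' by (rule Lagrange_identity_3)
    also have "\<dots> > 0"
    proof -
      have "W * (t2 - R) - W * (t1 - R) = W * (t2 - t1)" by (simp add: algebra_simps)
      then have "(W * (t2 - R) - W * (t1 - R))^2 > 0" using W \<open>t1 \<noteq> t2\<close> by simp
      then show ?thesis using p[OF roots(1)] p[OF roots(2)] p[OF roots(3)] 
        by (intro add_pos_nonneg mult_pos_pos mult_nonneg_nonneg) simp_all
    qed
    finally show ?thesis by (simp only: of_int_0_less_iff)
  qed
  have p3: "p t1 * p t2 * p t3 * W^2 = 1"
  proof -
    have "\<delta> t1 * \<delta> t2 * \<delta> t3 = of_int m^3 - of_int m^2 * of_int q * (t1 + t2 + t3) 
      + of_int m * of_int q^2 * (t1 * t2 + t1 * t3 + t2 * t3) - of_int q^3 * (t1 * t2 * t3)"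
      unfolding \<delta>_def by algebra
    also have "\<dots> = of_int (w^2)" unfolding sum_roots sum_mult_roots prod_roots norm by simp
    finally have "\<delta> t1 * \<delta> t2 * \<delta> t3 = W^2" by (simp add: W_def)
    then show ?thesis using W by (simp add: p_def)
  qed
  \<comment> \<open>The basis change from 1, \<theta>, \<open>\<theta>^2\<close> to the ideal basis
    has determinant \<open>w\<close>. Its square cancels the norm of \<delta>, and the discriminant
    of the ring remains.\<close>
  have D: "ternary_det a b c d e f = 49"
  proof -
    define V where "V = (t2 - t1) * (t3 - t1) * (t3 - t2)"
    have "real_of_int (ternary_det a b c d e f) = real_of_int a * real_of_int b * real_of_int c + 2 * real_of_int d * real_of_int e * real_of_int f 
      - real_of_int a * (real_of_int f)^2 - real_of_int b * (real_of_int e)^2 - real_of_int c * (real_of_int d)^2"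
      by (simp add: ternary_det_def)
    also have "\<dots> = p t1 * p t2 * p t3 * (W * ((t2 - R) * \<omega> t3 - (t3 - R) * \<omega> t2) - W * ((t1 - R) * \<omega> t3 - (t3 - R) * \<omega> t1) 
      + W * ((t1 - R) * \<omega> t2 - (t2 - R) * \<omega> t1))^2"
      unfolding a' b' c' d' e' f' by (rule Gram_det_3)
    also have "W * ((t2 - R) * \<omega> t3 - (t3 - R) * \<omega> t2) - W * ((t1 - R) * \<omega> t3 - (t3 - R) * \<omega> t1) 
      + W * ((t1 - R) * \<omega> t2 - (t2 - R) * \<omega> t1) = W * V"
      unfolding \<omega>_def V_def by algebra
    also have "p t1 * p t2 * p t3 * (W * V)^2 = (p t1 * p t2 * p t3 * W^2) * V^2"
        by (simp add: power_mult_distrib mult_ac)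
    also have "\<dots> = 49" unfolding p3 unfolding V_def discriminant_roots by simp
    finally show ?thesis by linarith
  qed
  have Dpos: "ternary_det a b c d e f > 0" using D by simp
  obtain x y z where xyz: "(x, y, z) \<noteq> (0, 0, 0)" "27 * ternary_form a b c d e f x y z ^ 3 \<le> 64 * 49"
    using Hermite_ternary[OF apos vpos Dpos, unfolded D] by (elim exE conjE) (rule that)
  define F where "F = ternary_form a b c d e f x y z"
  \<comment> \<open>A value of 5 would give \<open>27 * 125 = 3375\<close>, more than
    \<open>64 * 49 = 3136\<close>.\<close>
  have "F \<le> 4"
  proof (rule ccontr)
    assume "\<not> F \<le> 4"
    then have "5 ^ 3 \<le> F ^ 3" by (intro power_mono) simp_all
    then show False using xyz(2) by (simp add: F_def)
  qed
  \<comment> \<open>This is the square of the chosen ideal element divided by \<delta>, expanded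
    with \<kappa> and \<mu> so that it is integral; \<open>b0\<close>, \<open>b1\<close>,
    \<open>b2\<close> are the coordinates of that element.\<close>
  define \<gamma>
      where "\<gamma> t = \<kappa> t * of_int (x^2) + \<mu> t * ((t - R) * ((of_int y + of_int z * t) * (of_int y + of_int z * t)) + 
      W * (of_int (2 * x) * (of_int y + of_int z * t)))" for t
  have "integral_on_roots \<gamma>" unfolding \<gamma>_def 
    by (intro integral_on_roots_add ints integral_on_roots_of_int)
  then obtain g0 g1 g2 where g: "\<And>t. t \<in> roots \<Longrightarrow> \<gamma> t = ev g0 g1 g2 t"
      unfolding integral_on_roots_def by blast
  define b0 b1 b2 where "b0 = w * x - r * y" and "b1 = y - r * z" and "b2 = z"
  have \<gamma>: "\<gamma> t * \<delta> t = (ev b0 b1 b2 t)^2" if "t \<in> roots" for t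
  proof -
    define Y where "Y = of_int y + of_int z * t"
    have "\<gamma> t * \<delta> t = (\<kappa> t * \<delta> t) * of_int x^2 + (\<mu> t * \<delta> t) * ((t - R) * (Y * Y) + W * (2 * of_int x * Y))"
      unfolding \<gamma>_def Y_def[symmetric] by (simp add: algebra_simps)
    also have "\<dots> = (W * of_int x + (t - R) * Y)^2"
      unfolding \<kappa>[OF that] \<mu>[OF that] by algebra
    also have "W * of_int x + (t - R) * Y = ev b0 b1 b2 t"
      by (simp add: W_def R_def Y_def ev_def b0_def b1_def b2_def power2_eq_square algebra_simps)
    finally show ?thesis .
  qed
  have "b0 \<noteq> 0 \<or> b1 \<noteq> 0 \<or> b2 \<noteq> 0" using xyz(1) w0
      by (auto simp: b0_def b1_def b2_def)
  \<comment> \<open>A nonzero element has no vanishing conjugate. Hence \<gamma>, a nonzero square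
    divided by a positive number, is totally positive.\<close>
  then have "ev b0 b1 b2 t \<noteq> 0" if "t \<in> roots" for t using ev_eq_0D[OF that] by blast
  then have \<gamma>pos: "\<gamma> t > 0" if "t \<in> roots" for t 
    using \<gamma>[OF that] \<delta>pos[OF that] that by (metis zero_less_mult_pos2 zero_less_power2)
  have "\<gamma> t1 + \<gamma> t2 + \<gamma> t3 = of_int F"
  proof -
    define x' y' z' where "x' = real_of_int x" and "y' = real_of_int y" and "z' = real_of_int z"
    have "of_int F = of_int a * x'^2 + of_int b * y'^2 + of_int c * z'^2 + 2 * of_int d * (x' * y') + 2 * of_int e * (x' * z') + 2 * of_int f * (y' * z')"
      unfolding F_def ternary_form_def x'_def y'_def z'_def by simp
    also have "\<dots> = \<gamma> t1 + \<gamma> t2 + \<gamma> t3"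
      unfolding a[symmetric] b[symmetric] c[symmetric] d[symmetric] e[symmetric] f[symmetric] \<gamma>_def \<omega>_def
      by (simp add: x'_def[symmetric] y'_def[symmetric] z'_def[symmetric] power2_eq_square algebra_simps)
    finally show ?thesis ..
  qed
  then have "ev g0 g1 g2 t1 + ev g0 g1 g2 t2 + ev g0 g1 g2 t3 \<le> 4" using \<open>F \<le> 4\<close> g roots
      by simp
  then have g1: "g0 = 1 \<and> g1 = 0 \<and> g2 = 0" using eq_1_if_trace_le_4[of g0 g1 g2] \<gamma>pos g by simp
  then have "\<delta> t1 = ev b0 b1 b2 t1 * ev b0 b1 b2 t1" using \<gamma>[OF roots(1)] g[OF roots(1)]
      by (simp add: ev_def power2_eq_square)
  moreover have "\<delta> t1 = ev m (- q) 0 t1" by (simp add: \<delta>_def ev_def)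
  ultimately have "ev m (- q) 0 t1 = ev (b0*b0 - b1*b2 - b2*b1 + 3*b2*b2) (b0*b1 + b1*b0 + 4*b1*b2 + 4*b2*b1 - 13*b2*b2)
     (b0*b2 + b1*b1 + b2*b0 - 3*b1*b2 - 3*b2*b1 + 13*b2*b2) t1"
    using ev_mult[OF roots(1), of b0 b1 b2 b0 b1 b2] by (simp only:)
  from ev_eqD[OF roots(1) this] show thesis
    by (intro that[of b0 b1 b2]) (simp_all add: power2_eq_square algebra_simps)
qed

end

subsection \<open>Descent\<close>

text \<open>The signs of the cubic at -5, -1, 0, 1/2 and 1 separate three roots. The Vieta relations
  follow from its divided differences.\<close>

lemma cubic_roots_exist:
  obtains t1 t2 t3 :: real where "cubic_roots t1 t2 t3" "t1 < 0" "0 < t2" "t2 < 1/2"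
proof -
  define f where "f t = t^3 + 3*t^2 - 4*t + 1" for t :: real
  have root: "\<exists>t. a \<le> t \<and> t \<le> b \<and> f t = 0"
      if "a \<le> b" "f a \<le> 0 \<and> 0 \<le> f b \<or> f b \<le> 0 \<and> 0 \<le> f a" for a b
  proof -
    have "\<forall>x. a \<le> x \<and> x \<le> b \<longrightarrow> isCont f x" unfolding f_def
        by (intro allI impI continuous_intros)
    then show ?thesis using IVT[of f a 0 b] IVT2[of f b 0 a] that by blast
  qed
  obtain t1 where t1: "-5 \<le> t1" "t1 \<le> -1" "f t1 = 0" using root[of "-5" "-1"] by (auto simp: f_def)
  obtain t2 where t2: "0 \<le> t2" "t2 \<le> 1/2" "f t2 = 0" using root[of 0 "1/2"]
      by (auto simp: f_def power_divide)
  obtain t3 where t3: "1/2 \<le> t3" "t3 \<le> 1" "f t3 = 0" using root[of "1/2" 1]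
      by (auto simp: f_def power_divide)
  have "f 0 \<noteq> 0" "f (1/2) \<noteq> 0" by (simp_all add: f_def power_divide)
  then have bounds: "0 < t2" "t2 < 1/2" "1/2 < t3" using t2 t3 by (metis less_eq_real_def)+
  have quot: "x^2 + x*y + y^2 + 3*x + 3*y - 4 = 0" if "f x = 0" "f y = 0" "x \<noteq> y" for x y
  proof -
    have "(x - y) * (x^2 + x*y + y^2 + 3*x + 3*y - 4) = f x - f y" unfolding f_def by algebra
    then show ?thesis using that by simp
  qed
  have q12: "t1^2 + t1*t2 + t2^2 + 3*t1 + 3*t2 - 4 = 0" and q13: "t1^2 + t1*t3 + t3^2 + 3*t1 + 3*t3 - 4 = 0"
    using quot[OF t1(3) t2(3)] quot[OF t1(3) t3(3)] t1 bounds by auto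
  have "(t2 - t3) * (t1 + t2 + t3 + 3) = 0" using q12 q13 by algebra
  then have s: "t1 + t2 + t3 = - 3" using bounds by simp
  then have p: "t1 * t2 + t1 * t3 + t2 * t3 = - 4" using q12 s by algebra
  have "f t1 = 0" by (rule t1)
  then have "t1 * t2 * t3 = - 1" using s p unfolding f_def by algebra
  with s p have "cubic_roots t1 t2 t3" by unfold_locales
  then show thesis using that bounds t1 by simp
qed

text \<open>If \<open>m - s\<^sup>2 \<theta> = (b\<^sub>0 + b\<^sub>1 \<theta> + b\<^sub>2 \<theta>\<^sup>2)\<^sup>2\<close> then \<open>(b\<^sub>1 - 3 b\<^sub>2) / b\<^sub>2\<close> is the \<open>z\<close>-coordinate of a point
  whose double has the \<open>z\<close>-coordinate \<open>m / s\<^sup>2\<close>.\<close>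

lemma half_point:
  fixes m s w :: int
  assumes norm: "w^2 = m^3 + 3*m^2*s^2 - 4*m*(s^2)^2 + (s^2)^3" and "coprime s w" and s: "s > 0"
      and pos: "2 * m > s^2"
  obtains U b where "b \<noteq> 0" "s^2 * b = U^3 + 3*U^2*b - 4*U*b^2 + b^3"
    "4 * b^2 * m = U^4 + 8*U^2*b^2 - 8*U*b^3 + 4*b^4"
proof -
  define q where "q = s^2"
  have q: "q > 0" using s by (simp add: q_def)
  note norm = norm[folded q_def]
  have cop: "coprime q w" using assms(2) by (simp add: q_def)
  obtain t1 t2 t3 :: real where roots: "cubic_roots t1 t2 t3" and t: "t1 < 0" "0 < t2" "t2 < 1/2"
      by (rule cubic_roots_exist)
  interpret cubic_roots t1 t2 t3 by (rule roots)
  have "w \<noteq> 0"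
  proof
    assume "w = 0"
    then have "q = 1" using cop q by simp
    then have "m * (m^2 + 3*m - 4) = - 1" using norm \<open>w = 0\<close>
        by (simp add: power2_eq_square power3_eq_cube algebra_simps)
    then have "m dvd 1" by (metis dvd_minus_iff dvd_triv_left)
    then have "m = 1" using pos q unfolding q_def by (auto simp: zdvd1_eq)
    then show False using \<open>m * _ = - 1\<close> by simp
  qed
  have 12: "of_int m - of_int q * t > 0" if "t < 1/2" for t :: real
  proof -
    have "of_int q * t < of_int q * (1/2)" using q that by (intro mult_strict_left_mono) simp_all
    moreover have "real_of_int q < 2 * real_of_int m" using pos unfolding q_def[symmetric] by linarith
    ultimately show ?thesis by simp
  qed
  have "(of_int m - of_int q * t1) * (of_int m - of_int q * t2) * (of_int m - of_int q * t3) =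
      of_int m^3 - of_int m^2 * of_int q * (t1 + t2 + t3) 
      + of_int m * of_int q^2 * (t1 * t2 + t1 * t3 + t2 * t3) - of_int q^3 * (t1 * t2 * t3)"
    by algebra
  also have "\<dots> = of_int (w^2)" unfolding sum_roots sum_mult_roots prod_roots norm by simp
  finally have prod: "(of_int m - of_int q * t1) * (of_int m - of_int q * t2) * (of_int m - of_int q * t3) = of_int (w^2)" .
  \<comment> \<open>The position of \<open>m / q\<close> relative to the largest root is not known
    directly: the factors at the two smaller roots are positive and the product is a nonzero square,
    so the third factor is positive too.\<close>
  have "of_int (w^2) > (0::real)" using \<open>w \<noteq> 0\<close> by simp
  moreover have "(of_int m - of_int q * t1) * (of_int m - of_int q * t2) > 0"
    using 12[of t1] 12[of t2] t by (intro mult_pos_pos) simp_all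
  ultimately have "of_int m - of_int q * t3 > 0" 
    unfolding prod[symmetric] by (rule zero_less_mult_pos)
  then have pos: "of_int m - of_int q * t > 0" if "t \<in> roots" for t
    using that 12[of t1] 12[of t2] t unfolding roots_def by auto
  have "t1 \<noteq> t2" using t by simp
  obtain b0 b1 b2 where b: "m = b0^2 - 2*b1*b2 + 3*b2^2" "- q = 2*b0*b1 + 8*b1*b2 - 13*b2^2"
    "b1^2 + 2*b0*b2 - 6*b1*b2 + 13*b2^2 = 0"
    by (rule totally_positive_square[OF norm cop \<open>w \<noteq> 0\<close> pos \<open>t1 \<noteq> t2\<close>])
  show thesis
  \<comment> \<open>Put \<open>U = b1 - 3 * b2\<close>. The vanishing coefficient of
    \<open>\<theta>^2\<close> reads \<open>2 * b0 * b2 = - (U^2 + 4 * b2^2)\<close>; eliminating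
    \<open>b0\<close> from the other two relations gives the cubic and the quartic. If
    \<open>b2\<close> were 0, then \<open>b1\<close> and \<open>q\<close> would be 0 as
    well.\<close>
  proof (rule that[of b2 "b1 - 3 * b2"])
    show "b2 \<noteq> 0" using b q by auto
    show "s^2 * b2 = (b1 - 3*b2)^3 + 3*(b1 - 3*b2)^2*b2 - 4*(b1 - 3*b2)*b2^2 + b2^3"
      unfolding q_def[symmetric] using b(2,3) by algebra
    show "4 * b2^2 * m = (b1 - 3*b2)^4 + 8*(b1 - 3*b2)^2*b2^2 - 8*(b1 - 3*b2)*b2^3 + 4*b2^4"
      using b(1,3) by algebra
  qed
qed

section \<open>Heights and halving of rational points\<close>

definition height :: "rat \<Rightarrow> int" where
  "height r = max \<bar>fst (quotient_of r)\<bar> (snd (quotient_of r))"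

lemma height_coprime:
  assumes "coprime p q" "q > 0"
  shows "height (of_int p / of_int q) = max \<bar>p\<bar> q"
proof -
  have "quotient_of (of_int p / of_int q) = (p, q)"
    using assms by (simp add: Fract_of_int_quotient[symmetric] quotient_of_Fract normalize_stable)
  then show ?thesis by (simp add: height_def)
qed

lemma height_pos: "height r > 0"
  using quotient_of_denom_pos'[of r] by (simp add: height_def less_max_iff_disj)

lemma coprime_quotient_scale:
  fixes a b :: int
  assumes "b \<noteq> 0"
  obtains p q g
      where "q > 0" "coprime p q" "g \<noteq> 0" "a = p * g" "b = q * g" "rat_of_int a / of_int b = of_int p / of_int q"
proof -
  obtain p q :: int where q: "q > 0" "coprime p q" and r: "rat_of_int a / of_int b = of_int p / of_int q"
    by (rule rat_coprime_quotient)
  have "rat_of_int (a * q) = rat_of_int (p * b)" using r assms q by (simp add: field_simps)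
  then have aq: "a * q = p * b" by (simp only: of_int_eq_iff)
  then have "q dvd p * b" by (metis dvd_triv_right)
  then have "q dvd b" using q(2) by (simp add: coprime_dvd_mult_right_iff coprime_commute)
  then obtain g where g: "b = q * g" by blast
  then have "a = p * g" using aq q(1) by simp
  with g q r assms show thesis by (intro that) auto
qed

lemma height_le:
  assumes "b \<noteq> 0"
  shows "height (of_int a / of_int b) \<le> max \<bar>a\<bar> \<bar>b\<bar>"
proof -
  obtain p q g
      where q: "q > 0" "coprime p q" "g \<noteq> 0" "a = p * g" "b = q * g" "rat_of_int a / of_int b = of_int p / of_int q"
    using assms by (rule coprime_quotient_scale)
  have "\<bar>g\<bar> \<ge> 1" using q(3) by simp
  then have "\<bar>p\<bar> * 1 \<le> \<bar>p\<bar> * \<bar>g\<bar>" "\<bar>q\<bar> * 1 \<le> \<bar>q\<bar> * \<bar>g\<bar>" by (intro mult_left_mono; simp)+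
  then show ?thesis unfolding q(6) height_coprime[OF q(2,1)] using q(1,4,5) by (intro max.mono) (simp_all add: abs_mult)
qed

text \<open>In lowest terms \<open>p / q\<close> the quartic value \<open>N\<close> is prime to
  \<open>q\<close>, so \<open>4 * m\<close> is a nonzero square times \<open>N\<close>. Writing
  \<open>N\<close> as a sum of squares shows that it is at least \<open>p^4\<close> and
  \<open>q^4\<close>; thus the numerator \<open>m\<close> alone controls the height.\<close>

lemma half_point_height:
  fixes U b m :: int
  assumes "b \<noteq> 0" and eq: "4 * b^2 * m = U^4 + 8*U^2*b^2 - 8*U*b^3 + 4*b^4"
  shows "height (of_int U / of_int b) ^ 4 \<le> 4 * m"
proof -
  obtain p q g
      where q: "q > 0" "coprime p q" "g \<noteq> 0" "U = p * g" "b = q * g" "rat_of_int U / of_int b = of_int p / of_int q"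
    using assms(1) by (rule coprime_quotient_scale)
  define N where "N = p^4 + 8*p^2*q^2 - 8*p*q^3 + 4*q^4"
  have "g^2 * (4 * q^2 * m) = g^2 * (g^2 * N)"
    using eq unfolding q(4,5) N_def by algebra
  moreover have "g^2 \<noteq> 0" using q(3) by simp
  ultimately have gN: "4 * q^2 * m = g^2 * N" by (metis mult_left_cancel)
  have "coprime q N"
  proof (rule coprime_add_multI)
    show "coprime q (p^4)" using q(2) by (simp add: coprime_commute)
    show "N = (8*p^2*q - 8*p*q^2 + 4*q^3) * q + p^4"
        by (simp add: N_def algebra_simps power2_eq_square power3_eq_cube power4_eq_xxxx)
  qed
  then have "coprime (q^2) N" by simp
  moreover have "q^2 dvd g^2 * N" unfolding gN[symmetric] by simp
  ultimately have "q^2 dvd g^2" by (simp add: coprime_dvd_mult_left_iff)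
  then have "q dvd g" by (simp add: pow_divides_pow_iff)
  then obtain h where h: "g = q * h" by blast
  have "q^2 * (4 * m) = q^2 * (h^2 * N)" using gN unfolding h by (simp add: power_mult_distrib mult_ac)
  then have m: "4 * m = h^2 * N" using q(1) by simp
  have "h^2 \<ge> 1" using h q(3) by (simp add: int_one_le_iff_zero_less)
  have N: "N = (p^2)^2 + 2 * ((2*p - q) * q)^2 + 2 * q^4" unfolding N_def by algebra
  have p4: "p^4 = (p^2)^2" by (simp flip: power_mult)
  have "N \<ge> q^4" "N \<ge> p^4"  using q(1) zero_le_power2[of "p^2"] zero_le_power2[of "(2*p - q) * q"]
      unfolding N p4
    by (simp_all add: add_nonneg_nonneg)
  then have "max \<bar>p\<bar> q ^ 4 \<le> N" by (simp add: max_def)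
  moreover have "N \<le> h^2 * N" using \<open>h^2 \<ge> 1\<close> \<open>N \<ge> q^4\<close> q(1) 
    by (metis mult_right_mono mult_1 order_trans less_imp_le zero_less_power)
  ultimately show ?thesis unfolding q(6) height_coprime[OF q(2,1)] m by simp
qed

text \<open>For \<open>z = p / q\<close> in lowest terms, \<open>q\<close> times the homogenized
  cubic is a square and the two are coprime, so the positive denominator \<open>q\<close> is itself
  a square.\<close>

lemma rational_point_coordinates:
  fixes y z :: rat
  assumes y: "y^2 = z^3 + 3*z^2 - 4*z + 1"
  obtains m s w :: int
      where "s > 0" "coprime m s" "coprime s w" "z = of_int m / of_int s^2" "y = of_int w / of_int s^3"
    "w^2 = m^3 + 3*m^2*s^2 - 4*m*(s^2)^2 + (s^2)^3"
proof -
  obtain p q :: int where q: "q > 0" "coprime p q" and z: "z = of_int p / of_int q"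
    by (rule rat_coprime_quotient)
  define N where "N = p^3 + 3*p^2*q - 4*p*q^2 + q^3"
  have qN: "of_int N = of_int q^3 * y^2"
    using q(1) unfolding y z N_def by (simp add: field_simps power2_eq_square power3_eq_cube)
  then have "(y * of_int q^2)^2 = of_int (q * N)"
    by (simp add: power_mult_distrib power2_eq_square power3_eq_cube)
  then obtain k where k: "q * N = k^2" by (rule rat_square_of_int)
  have cop: "coprime q N"
  proof (rule coprime_add_multI)
    show "coprime q (p^3)" using q(2) by (simp add: coprime_commute)
    show "N = (3*p^2 - 4*p*q + q^2) * q + p^3"
        by (simp add: N_def power2_eq_square power3_eq_cube algebra_simps)
  qed
  then obtain e u v where e: "e = 1 \<or> e = -1" and u: "q = e * u^2" and v: "N = e * v^2"
    using k by (rule coprime_mult_eq_squareE)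
  have "e = 1"
  proof (rule ccontr)
    assume "e \<noteq> 1"
    then have "q = - (u^2)" using e u by simp
    then show False using q(1) zero_le_power2[of u] by linarith
  qed
  define s where "s = \<bar>u\<bar>"
  have qs: "q = s^2" using u \<open>e = 1\<close> by (simp add: s_def)
  have Nv: "N = v^2" using v \<open>e = 1\<close> by simp
  have "u \<noteq> 0" using u q(1) by auto
  then have s: "s > 0" by (simp add: s_def)
  have "(y * of_int s^3)^2 = of_int v^2"
    using qN unfolding qs Nv by (simp add: power_mult_distrib mult_ac flip: power_mult)
  then have "y * of_int s^3 = of_int v \<or> y * of_int s^3 = of_int (- v)" by (simp add: power2_eq_iff)
  then obtain w where w: "y * of_int s^3 = of_int w" "w = v \<or> w = - v" by metis
  show thesis
  proof (rule that)
    show "s > 0" by (rule s)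
    show "coprime p s" "z = of_int p / of_int s^2" using q z qs by simp_all
    show "coprime s w" using cop w(2) unfolding qs Nv by auto
    show "y = of_int w / of_int s^3" using w(1) s by (simp add: nonzero_eq_divide_eq)
    show "w^2 = p^3 + 3*p^2*s^2 - 4*p*(s^2)^2 + (s^2)^3"
      using w(2) Nv unfolding N_def qs by auto
  qed
qed

text \<open>The halved point is (U / b, s / b). Only the \<open>z\<close>-coordinate of its double
  is controlled; the sign of \<open>y\<close> is settled later by negation.\<close>

lemma half_of_rational_point:
  fixes y z :: rat
  assumes "on_E (Affine (z - 1) y)" and z: "z > 1/2"
  obtains r x y'
      where "on_E r" "r = Affine (x - 1) y'" "height x ^ 4 \<le> 4 * height z" "\<exists>y. add_E r r = Affine (z - 1) y"
proof -
  have "y^2 = z^3 + 3*z^2 - 4*z + 1" using assms(1) by (simp only: on_E_iff)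
  then obtain m s w :: int where s: "s > 0" and ms: "coprime m s" and sw: "coprime s w"
      and zs: "z = of_int m / of_int s^2"
    and norm: "w^2 = m^3 + 3*m^2*s^2 - 4*m*(s^2)^2 + (s^2)^3" by (rule rational_point_coordinates)
  have "rat_of_int (s^2) < of_int (2 * m)" using z s unfolding zs by (simp add: field_simps)
  then have "2 * m > s^2" by (simp only: of_int_less_iff)
  with norm sw s obtain U b where b: "b \<noteq> 0" and cubic: "s^2 * b = U^3 + 3*U^2*b - 4*U*b^2 + b^3"
    and quartic: "4 * b^2 * m = U^4 + 8*U^2*b^2 - 8*U*b^3 + 4*b^4" by (rule half_point)
  define B V S where "B = rat_of_int b" and "V = rat_of_int U" and "S = rat_of_int s"
  have B: "B \<noteq> 0" and S: "S \<noteq> 0" using b s by (simp_all add: B_def S_def)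
  have cubic': "S^2 * B = V^3 + 3*V^2*B - 4*V*B^2 + B^3"
    using arg_cong[OF cubic, of rat_of_int] by (simp add: B_def V_def S_def)
  have quartic': "4 * B^2 * of_int m = V^4 + 8*V^2*B^2 - 8*V*B^3 + 4*B^4"
    using arg_cong[OF quartic, of rat_of_int] by (simp add: B_def V_def)
  have "(S / B)^2 = (S^2 * B) / B^3" using B by (simp add: power2_eq_square power3_eq_cube)
  also have "\<dots> = (V / B)^3 + 3*(V / B)^2 - 4*(V / B) + 1"
    unfolding cubic' using B by (simp add: power2_eq_square power3_eq_cube field_simps)
  finally have on: "on_E (Affine (V / B - 1) (S / B))" by (simp only: on_E_iff)
  have "((V / B)^4 + 8*(V / B)^2 - 8*(V / B) + 4) / (4 * (S / B)^2) = (4 * B^2 * of_int m) / (4 * S^2 * B^2)"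
    unfolding quartic' using B S by (simp add: power2_eq_square power3_eq_cube power4_eq_xxxx field_simps)
  also have "\<dots> = z" using B S unfolding zs S_def[symmetric] by (simp add: field_simps)
  finally have double: "((V / B)^4 + 8*(V / B)^2 - 8*(V / B) + 4) / (4 * (S / B)^2) = z" .
  have "S / B \<noteq> 0" using B S by simp
  then have "\<exists>y. add_E (Affine (V / B - 1) (S / B)) (Affine (V / B - 1) (S / B)) = Affine (z - 1) y"
    using double_E[OF on] unfolding double by metis
  moreover have "height z = max \<bar>m\<bar> (s^2)" 
    using height_coprime[of m "s^2"] ms s unfolding zs by simp
  then have "height (V / B) ^ 4 \<le> 4 * height z"
    using half_point_height[OF b quartic] unfolding V_def B_def by linarith
  ultimately show thesis using that on by blast
qed

section \<open>Points of small height and the bounded component\<close>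

lemma not_square_between:
  fixes w k :: int
  assumes "k^2 < n" "n < (k + 1)^2" "k \<ge> 0"
  shows "w^2 \<noteq> n"
proof
  assume "w^2 = n"
  then have "k^2 < \<bar>w\<bar>^2" "\<bar>w\<bar>^2 < (k + 1)^2" using assms by simp_all
  then have "k < \<bar>w\<bar>" "\<bar>w\<bar> < k + 1" using assms(3) power_less_imp_less_base by fastforce+
  then show False by simp
qed

lemma orbit_E_small:
  "orbit_E 1 = (Affine (0 - 1) 1 :: rat ell_point)" 
  "orbit_E 2 = (Affine (1 - 1) 1 :: rat ell_point)" 
  "orbit_E 3 = (Affine (- 4 - 1) (- 1) :: rat ell_point)"
proof -
  show 1: "orbit_E 1 = (Affine (0 - 1) 1 :: rat ell_point)" by (simp add: orbit_E_1)
  then show 2: "orbit_E 2 = (Affine (1 - 1) 1 :: rat ell_point)" 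
    using shift_orbit_E[of 1, where 'a = rat] by (simp add: shift_def third_point_def Let_def)
  then show "orbit_E 3 = (Affine (- 4 - 1) (- 1) :: rat ell_point)" 
    using shift_orbit_E[of 2, where 'a = rat] by (simp add: shift_def third_point_def Let_def)
qed

lemma orbit_E_eq_up_to_sign:
  assumes "on_E (Affine x (y :: rat))" "Affine x y' = orbit_E n"
  shows "\<exists>n. Affine x y = orbit_E n"
proof -
  have "on_E (Affine x y')" unfolding assms(2) by simp
  then have "y^2 = y'^2" using assms(1) by simp
  then have "y = y' \<or> y = - y'" by (simp add: power2_eq_iff)
  then show ?thesis using assms(2) orbit_E_uminus[of n, where 'a = rat] by (metis ell_neg.simps(2))
qed

lemma small_height_in_orbit:
  fixes y z :: rat
  assumes on: "on_E (Affine (z - 1) y)" and h: "height z \<le> 4"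
  shows "\<exists>n. Affine (z - 1) y = orbit_E n"
proof -
  have "y^2 = z^3 + 3*z^2 - 4*z + 1" using on by (simp only: on_E_iff)
  then obtain m s w :: int where s: "s > 0" and ms: "coprime m s" and zs: "z = of_int m / of_int s^2"
    and norm: "w^2 = m^3 + 3*m^2*s^2 - 4*m*(s^2)^2 + (s^2)^3" by (rule rational_point_coordinates)
  have "height z = max \<bar>m\<bar> (s^2)" 
    using height_coprime[of m "s^2"] ms s unfolding zs by simp
  then have m: "\<bar>m\<bar> \<le> 4" and "s^2 \<le> 4" using h by simp_all
  have "s \<le> 2"
  proof (rule ccontr)
    assume "\<not> s \<le> 2"
    then have "3^2 \<le> s^2" by (intro power_mono) simp_all
    then show False using \<open>s^2 \<le> 4\<close> by simp
  qed
  then consider "s = 1" | "s = 2" using s by linarith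
  then have "s = 1 \<and> m \<in> {0, 1, - 4}"
  proof cases
    case 1
    \<comment> \<open>The remaining numerators give the values 13, 7, 43 and 97 for
      \<open>s = 1\<close>, and 337, 139, 13 and 7 for \<open>s = 2\<close>. None of them is a
      square.\<close>
    have "m \<in> {-4, -3, -2, -1, 0, 1, 2, 3, 4}" using m by auto
    then show ?thesis using norm 1 not_square_between[of 3 13 w] not_square_between[of 2 7 w] 
        not_square_between[of 6 43 w] not_square_between[of 9 97 w] by (elim insertE emptyE) simp_all
  next
    case 2
    have "odd m" using ms 2 by simp
    moreover have "m \<in> {-4, -3, -2, -1, 0, 1, 2, 3, 4}" using m by auto
    ultimately have "m \<in> {-3, -1, 1, 3}" by auto
    then show ?thesis using norm 2 not_square_between[of 3 13 w] not_square_between[of 2 7 w] 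
        not_square_between[of 11 139 w] not_square_between[of 18 337 w] by (elim insertE emptyE) simp_all
  qed
  then have "z = 0 \<or> z = 1 \<or> z = - 4" using zs by auto
  then show ?thesis using orbit_E_eq_up_to_sign[OF on] orbit_E_small by metis
qed

text \<open>The points with \<open>z < 1/2\<close> form the bounded real component, from which adding \<open>P\<^sub>0\<close> leads to the other one.\<close>

lemma shift_bounded_component:
  fixes y z :: rat
  assumes on: "on_E (Affine (z - 1) y)" and z: "z < 1/2" "z \<noteq> 0" and y: "y \<ge> 0"
  obtains y'
      where "shift (Affine (z - 1) y) = Affine ((2 - 4*z - 2*y) / z^2 - 1) y'" "(2 - 4*z - 2*y) / z^2 > 1/2"
proof -
  have yz: "y^2 = z^3 + 3*z^2 - 4*z + 1" using on by (simp only: on_E_iff)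
  define u where "u = (y - 1) / z"
  have yu: "y = 1 + u * z" using z by (simp add: u_def)
  have "z * (z^2 + (3 - u^2) * z - (4 + 2 * u)) = 0" 
    using yz unfolding yu by (simp add: power2_eq_square power3_eq_cube algebra_simps)
  then have rel: "slope_rel z u" using z by (simp add: slope_rel_def)
  have sh: "shift (Affine (z - 1) y) = Affine (u^2 - 3 - z - 1) (- (1 + u * (u^2 - 3 - z)))"
    using shift_slope_point[OF rel] by (simp only: slope_point_def yu ell_neg.simps)
  have "(u^2 - 3 - z) * z^2 = (y - 1)^2 - 3 * z^2 - z^3"
    using z by (simp add: u_def power_divide field_simps power2_eq_square power3_eq_cube)
  also have "\<dots> = 2 - 4*z - 2*y" using yz by (simp add: power2_eq_square algebra_simps)
  finally have eq: "u^2 - 3 - z = (2 - 4*z - 2*y) / z^2" using z by (simp add: nonzero_eq_divide_eq)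
  have f: "z^3 + 3*z^2 - 4*z + 1 \<ge> 0" unfolding yz[symmetric] by simp
  \<comment> \<open>The new coordinate exceeds 1/2 exactly when \<open>y < 1 - 2*z - z^2/4\<close>.
    Once this bound is known to be positive, comparing squares suffices.\<close>
  have pos: "1 - 2*z - z^2/4 > 0"
  proof (cases "z > 0")
    case True
    have "z * z \<le> z * (1/2)" using True z by (intro mult_left_mono) simp_all
    moreover have "z * (z * z) \<le> z * (1/4)" 
    proof -
      have "z * z \<le> (1/2) * (1/2)" using True z by (intro mult_mono) simp_all
      then show ?thesis using True by (intro mult_left_mono) simp_all
    qed
    \<comment> \<open>Replacing \<open>z^2\<close> by \<open>z/2\<close> and \<open>z^3\<close> by
      \<open>z/4\<close> bounds the cubic above by \<open>1 - 9*z/4\<close>.\<close>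
    ultimately have "z \<le> 4/9" using f by (simp add: power2_eq_square power3_eq_cube)
    moreover have "z * z \<le> 4/9 * (4/9)" using True \<open>z \<le> 4/9\<close> by (intro mult_mono) simp_all
    ultimately show ?thesis by (simp add: power2_eq_square)
  next
    case False
    have "z > - 5"
    proof (rule ccontr)
      assume "\<not> z > - 5"
      then have "z^2 * (z + 3) \<le> z^2 * (- 2)" by (intro mult_left_mono) simp_all
      moreover have "(- 2 * z) * (z + 2) \<le> (- 2 * z) * (- 3)" using \<open>\<not> z > - 5\<close>
          by (intro mult_left_mono) simp_all
      ultimately show False using f \<open>\<not> z > - 5\<close> by (simp add: power2_eq_square power3_eq_cube algebra_simps)
    qed
    then have "- z * (2 + z/4) \<ge> 0" using False by (intro mult_nonneg_nonneg) simp_all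
    then show ?thesis by (simp add: power2_eq_square algebra_simps)
  qed
  have "(1 - 2*z - z^2/4)^2 - y^2 = (z^2)^2/16 + z^2/2"
    unfolding yz by (simp add: power2_eq_square power3_eq_cube field_simps)
  moreover have "(z^2)^2/16 + z^2/2 > 0" using z by (intro add_pos_pos) simp_all
  ultimately have "y^2 < (1 - 2*z - z^2/4)^2" by linarith
  then have "y < 1 - 2*z - z^2/4" using pos by (intro power_less_imp_less_base[of y 2]) simp_all
  then have "(2 - 4*z - 2*y) / z^2 > 1/2" using z by (simp add: field_simps)
  then show thesis using that sh unfolding eq by blast
qed

lemma height_shift_bounded_component:
  fixes y z :: rat
  assumes on: "on_E (Affine (z - 1) y)" and z: "z \<noteq> 0" and y: "y \<ge> 0"
      and pos: "(2 - 4*z - 2*y) / z^2 > 0"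
  shows "height ((2 - 4*z - 2*y) / z^2) \<le> 6 * height z ^ 2"
proof -
  have "y^2 = z^3 + 3*z^2 - 4*z + 1" using on by (simp only: on_E_iff)
  then obtain m s w :: int where s: "s > 0" and ms: "coprime m s" and zs: "z = of_int m / of_int s^2"
      and ys: "y = of_int w / of_int s^3"
    by (rule rational_point_coordinates)
  define h where "h = height z"
  have "h = max \<bar>m\<bar> (s^2)" unfolding h_def
    using height_coprime[of m "s^2"] ms s unfolding zs by simp
  then have m: "\<bar>m\<bar> \<le> h" and sh: "s^2 \<le> h" by simp_all
  have h: "h \<ge> 0" using m by linarith
  define k where "k = 2*(s^2)^2 - 4*m*s^2 - 2*w*s"
  have m0: "m \<noteq> 0" using z zs by auto
  have eq: "(2 - 4*z - 2*y) / z^2 = of_int k / of_int (m^2)"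
    using s m0 unfolding zs ys k_def by (simp add: field_simps power2_eq_square power3_eq_cube)
  have "rat_of_int k > 0" using pos m0 unfolding eq by (simp add: zero_less_divide_iff)
  then have k0: "k > 0" by simp
  have "w \<ge> 0" using y s unfolding ys by (simp add: zero_le_divide_iff)
  then have "k \<le> 2*(s^2)^2 + 4*(\<bar>m\<bar>*s^2)" 
  proof -
    have "- m * s^2 \<le> \<bar>m\<bar> * s^2" by (intro mult_right_mono) simp_all
    moreover have "w * s \<ge> 0" using \<open>w \<ge> 0\<close> s by simp
    ultimately show ?thesis unfolding k_def by simp
  qed
  also have "\<dots> \<le> 2*h^2 + 4*(h*h)"
    using m sh h by (intro add_mono mult_left_mono mult_mono power_mono) simp_all
  finally have "k \<le> 6 * h^2" by (simp add: power2_eq_square)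
  moreover have "m^2 \<le> h^2" using m h by (simp add: abs_le_square_iff[symmetric])
  moreover have "height (of_int k / of_int (m^2)) \<le> max \<bar>k\<bar> \<bar>m^2\<bar>" using m0
      by (intro height_le) simp
  ultimately show ?thesis unfolding eq h_def[symmetric] using k0 zero_le_power2[of h] by simp
qed

theorem rational_points_in_orbit:
  fixes y z :: rat
  assumes "on_E (Affine (z - 1) y)"
  shows "\<exists>n. Affine (z - 1) y = orbit_E n"
  using assms
proof (induction "nat (height z)" arbitrary: z y rule: less_induct)
  case less
  define h where "h = height z"
  \<comment> \<open>Stated for a point other than the given one, so that it also applies after a
    shift. The bound is what makes the halved point lower than the original height
    \<open>h\<close>.\<close>
  have descent: "\<exists>n. Affine (z' - 1) y' = orbit_E n" 
    if on: "on_E (Affine (z' - 1) y')" and z': "z' > 1/2" and h': "4 * height z' < h^4" for z' y'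
  proof -
    obtain r x v
        where r: "on_E r" "r = Affine (x - 1) v" "height x ^ 4 \<le> 4 * height z'" "\<exists>y. add_E r r = Affine (z' - 1) y"
      by (rule half_of_rational_point[OF on z'])
    have "height x ^ 4 < h^4" using r(3) h' by simp
    then have "height x < h"
        by (rule power_less_imp_less_base) (use height_pos[of z] in \<open>simp add: h_def\<close>)
    then have "nat (height x) < nat (height z)" using height_pos[of x] unfolding h_def by simp
    then obtain n where "r = orbit_E n" using less(1) r(1,2) by blast
    then have "\<exists>y. Affine (z' - 1) y = orbit_E (n + n)" using r(4) orbit_E_add[of n n,
        where 'a = rat] by metis
    then show ?thesis using orbit_E_eq_up_to_sign[OF on] by blast
  qed
  show ?case
  proof (cases "h \<le> 4")
    case True
    then show ?thesis using small_height_in_orbit[OF less(2)] by (simp add: h_def)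
  next
    case False
    have h2: "5 * 5 \<le> h * h" using False by (intro mult_mono) simp_all
    then have "25 * h^2 \<le> h^2 * h^2" by (intro mult_right_mono) (simp_all add: power2_eq_square)
    \<comment> \<open>The factor 25 leaves room for the constant \<open>4 * 6\<close> that arises
      from a shift followed by a halving.\<close>
    then have h4: "25 * h^2 \<le> h^4" by (simp flip: power_add)
    have "h * 1 \<le> h * h" using False by (intro mult_left_mono) simp_all
    then have hh: "h \<le> h^2" by (simp add: power2_eq_square)
    have y: "y^2 = z^3 + 3*z^2 - 4*z + 1" using less(2) by (simp only: on_E_iff)
    have "z \<noteq> 1/2"
    proof
      assume "z = 1/2"
      then have "y^2 = - 1/8" unfolding y \<open>z = 1/2\<close> by (simp add: power_divide)
      then show False using zero_le_power2[of y] by linarith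
    qed
    then consider "z > 1/2" | "z < 1/2" by linarith
    then show ?thesis
    proof cases
      case 1
      then show ?thesis using descent[OF less(2)] h4 hh False by (simp add: h_def)
    next
      case 2
      have "height 0 = 1" by (simp add: height_def)
      then have z0: "z \<noteq> 0" using False by (auto simp: h_def)
      \<comment> \<open>Negation stays inside the orbit, so the sign of \<open>y\<close> may be
        chosen to suit the height estimate.\<close>
      define y' where "y' = \<bar>y\<bar>"
      have on: "on_E (Affine (z - 1) y')" using less(2) by (simp add: y'_def)
      have y': "y' \<ge> 0" by (simp add: y'_def)
      obtain v where v: "shift (Affine (z - 1) y') = Affine ((2 - 4*z - 2*y') / z^2 - 1) v"
          and gt: "(2 - 4*z - 2*y') / z^2 > 1/2"
        by (rule shift_bounded_component[OF on 2 z0 y'])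
      have "height ((2 - 4*z - 2*y') / z^2) \<le> 6 * h^2"
        using height_shift_bounded_component[OF on z0 y'] gt by (simp add: h_def)
      moreover have "h^2 > 0" using False by simp
      ultimately have "4 * height ((2 - 4*z - 2*y') / z^2) < h^4" using h4 by linarith
      moreover have "on_E (Affine ((2 - 4*z - 2*y') / z^2 - 1) v)" using on_E_shift[OF on] unfolding v .
      ultimately obtain n where "shift (Affine (z - 1) y') = orbit_E n" using descent gt unfolding v by blast
      then have "Affine (z - 1) y' = orbit_E (n - 1)" by (rule shift_eq_orbit_E[OF on])
      then show ?thesis by (rule orbit_E_eq_up_to_sign[OF less(2)])
    qed
  qed
qed

section \<open>The group of rational points is infinite cyclic\<close>

lemma orbit_E_iso: "orbit_E \<in> iso integer_group E7"
proof (rule isoI)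
  show "orbit_E \<in> hom integer_group E7"
    by (rule homI) (simp_all add: carrier_E7 mult_E7 orbit_E_add)
  have "p \<in> range orbit_E" if "on_E p" for p :: "rat ell_point"
  proof (cases p)
    case Infinity
    then have "p = orbit_E 0" by simp
    then show ?thesis by (rule range_eqI)
  next
    case (Affine x y)
    have "p = Affine ((x + 1) - 1) y" by (simp add: Affine)
    then show ?thesis using rational_points_in_orbit[of "x + 1" y] that by auto
  qed
  then show "bij_betw orbit_E (carrier integer_group) (carrier E7)"
    using inj_orbit_E by (auto simp: bij_betw_def carrier_E7)
qed

text \<open>Every point is a multiple of the base point, so associativity is that of integer
  addition, and the inverses come from the isomorphism.\<close>

lemma group_E7: "group E7"
proof -
  have closed: "\<exists>n. p = orbit_E n" if "p \<in> carrier E7" for p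
    using orbit_E_iso that by (auto simp: iso_def bij_betw_def)
  have "monoid E7"
  proof (rule monoidI)
    fix p q r assume "p \<in> carrier E7" "q \<in> carrier E7" "r \<in> carrier E7"
    then obtain i j k where *: "p = orbit_E i" "q = orbit_E j" "r = orbit_E k" using closed by meson
    show "p \<otimes>\<^bsub>E7\<^esub> q \<in> carrier E7" unfolding *
        by (simp add: mult_E7 carrier_E7 orbit_E_add)
    show "p \<otimes>\<^bsub>E7\<^esub> q \<otimes>\<^bsub>E7\<^esub> r = p \<otimes>\<^bsub>E7\<^esub> (q \<otimes>\<^bsub>E7\<^esub> r)"
      unfolding * mult_E7 orbit_E_add by (simp add: add.assoc)
  qed (simp_all add: carrier_E7 mult_E7 one_E7)
  then show ?thesis by (rule group_if_integer_group_iso[OF orbit_E_iso])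
qed

lemma base_point_int_pow: "base_point [^]\<^bsub>E7\<^esub> (m::int) = orbit_E m"
proof -
  interpret group E7 by (rule group_E7)
  have nat: "base_point [^]\<^bsub>E7\<^esub> (n::nat) = orbit_E (int n)" for n
  proof (induction n)
    case (Suc n)
    then show ?case using orbit_E_add[of "int n" 1, where 'a = rat] by (simp add: mult_E7 orbit_E_1 add.commute)
  qed (simp add: one_E7)
  have inv: "inv\<^bsub>E7\<^esub> (orbit_E n) = orbit_E (- n)" for n
    by (rule inv_equality) (simp_all add: mult_E7 one_E7 orbit_E_add carrier_E7)
  show ?thesis
    by (cases "m \<ge> 0") (simp_all add: int_pow_def2 nat inv)
qed

lemma carrier_E7_generate: "carrier E7 = generate E7 {base_point}"
proof -
  interpret group E7 by (rule group_E7)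
  have "generate E7 {base_point} = range (\<lambda>k::int. base_point [^]\<^bsub>E7\<^esub> k)"
    by (subst generate_pow) (auto simp: carrier_E7)
  also have "\<dots> = carrier E7"
    using orbit_E_iso by (simp add: base_point_int_pow iso_def bij_betw_def)
  finally show ?thesis ..
qed

lemma lucas_U_7_square_iff:
  assumes "P \<noteq> 0"
  shows "is_square (lucas_U P Q 7) \<longleftrightarrow>
         (\<exists>m::int. \<exists>y::rat. m \<noteq> 0 \<and>
            Affine (- rat_of_int Q / (rat_of_int P)^2) y = base_point [^]\<^bsub>E7\<^esub> m)"
  unfolding lucas_U_7_square_iff_on_E[OF assms] base_point_int_pow
proof safe
  fix y assume "on_E (Affine (- rat_of_int Q / (rat_of_int P)^2) y)"
  then obtain m where m: "Affine (- rat_of_int Q / (rat_of_int P)^2) y = orbit_E m" 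
    using rational_points_in_orbit[of "- rat_of_int Q / (rat_of_int P)^2 + 1" y] by auto
  then have "m \<noteq> 0" by auto
  then show "\<exists>m y. m \<noteq> 0 \<and> Affine (- rat_of_int Q / (rat_of_int P)^2) y = orbit_E m"
      using m by blast
next
  fix m y assume "Affine (- rat_of_int Q / (rat_of_int P)^2) y = orbit_E m"
  then have "on_E (Affine (- rat_of_int Q / (rat_of_int P)^2) y)" by (simp only: on_E_orbit)
  then show "\<exists>y. on_E (Affine (- rat_of_int Q / (rat_of_int P)^2) y)" by blast
qed

theorem mainTheorem2:
  fixes P Q :: int
  assumes "P \<noteq> 0" and "Q \<noteq> 0"
    and "gcd P Q = 1"
    and "(P, Q) \<notin> {(1, 1), (-1, 1), (2, 1), (-2, 1)}"
  shows
    "(is_square (lucas_U P Q 2) \<longleftrightarrow> (\<exists>a::int. P = a^2))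
     \<and>
     (is_square (lucas_U P Q 3) \<longleftrightarrow> (\<exists>a::int. P^2 - Q = a^2))
     \<and>
     (is_square (lucas_U P Q 4) \<longleftrightarrow>
        (\<exists>\<delta>\<in>{1, -1 :: int}. \<exists>a b :: int.
            (P = \<delta> * a^2 \<and> rat_of_int Q = 1/2 * rat_of_int (a^4 - \<delta> * b^2) \<and> odd (a * b))
          \<or> (P = 2 * \<delta> * a^2 \<and> Q = 2 * a^4 - \<delta> * b^2 \<and> odd b)))
     \<and>
     (is_square (lucas_U P Q 5) \<longleftrightarrow>
        (\<exists>a b :: int. coprime a b \<and> a \<noteq> 0 \<and> b \<noteq> 0 \<and> \<not> 5 dvd b \<and>
           ((even a \<noteq> even b \<and>
               ((P, Q) = (2 * a * b, 5 * a^4 + 6 * a^2 * b^2 + b^4)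
              \<or> (P, Q) = (2 * a * b, - 5 * a^4 + 6 * a^2 * b^2 - b^4)))
          \<or> (odd a \<and> odd b \<and>
               ((P, rat_of_int Q) =
                  (a * b, 1/4 * rat_of_int (5 * a^4 + 6 * a^2 * b^2 + b^4))
              \<or> (P, rat_of_int Q) =
                  (a * b, 1/4 * rat_of_int (- 5 * a^4 + 6 * a^2 * b^2 - b^4)))))))
     \<and>
     (is_square (lucas_U P Q 6) \<longleftrightarrow>
        (\<exists>a b :: int.
            (P = a^2 \<and> P^2 - Q = b^2 \<and> is_square (- 2 * a^4 + 3 * b^2))
          \<or> (P = a^2 \<and> P^2 - Q = - 2 * b^2 \<and> is_square (a^4 + 3 * b^2))
          \<or> (P = - (a^2) \<and> P^2 - Q = 2 * b^2 \<and> is_square (a^4 - 3 * b^2))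
          \<or> (\<exists>\<delta>\<in>{1, -1, 2, -2 :: int}.
               P = 3 * a^2 \<and> P^2 - Q = \<delta> * b^2 \<and> is_square (- (6 div \<delta>) * a^4 + b^2))))
     \<and>
     (is_elliptic_curve (6::rat) 5 1 \<and>
      torsion E7 = {\<one>\<^bsub>E7\<^esub>} \<and>
      has_rank E7 1 \<and>
      Affine (-1) 1 \<in> carrier E7 \<and>
      carrier E7 = generate E7 {Affine (-1) 1} \<and>
      (is_square (lucas_U P Q 7) \<longleftrightarrow>
         (\<exists>m::int. \<exists>y::rat. m \<noteq> 0 \<and>
            Affine (- rat_of_int Q / (rat_of_int P)^2) y = Affine (-1) 1 [^]\<^bsub>E7\<^esub> m)))"
proof (intro conjI)
  show "is_square (lucas_U P Q 2) \<longleftrightarrow> (\<exists>a::int. P = a^2)" 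
    by (simp only: lucas_U_2 is_square_iff)
  show "is_square (lucas_U P Q 3) \<longleftrightarrow> (\<exists>a::int. P^2 - Q = a^2)"
    by (simp only: lucas_U_3 is_square_iff)
  show "is_elliptic_curve (6::rat) 5 1" by (simp add: is_elliptic_curve_def ell_discriminant_def)
  show "torsion E7 = {\<one>\<^bsub>E7\<^esub>}" by (rule torsion_integer_group_iso[OF orbit_E_iso group_E7])
  show "has_rank E7 1" by (rule has_rank_1_if_integer_group_iso[OF orbit_E_iso group_E7])
  show "base_point \<in> carrier E7" by (simp add: carrier_E7)
qed (fact lucas_U_4_square_iff[OF assms(1) assms(3)[folded coprime_iff_gcd_eq_1]] lucas_U_5_square_iff[OF assms(1) assms(3)[folded coprime_iff_gcd_eq_1]]
  lucas_U_6_square_iff[OF assms(1) assms(3)[folded coprime_iff_gcd_eq_1]] carrier_E7_generate lucas_U_7_square_iff[OF assms(1)])+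

end
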